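(* Let $Q=(q_{ij})_{i,j\in\mathcal{S}}$ be a quasi-stochastic matrix with positive left and right eigenvectors $\mathsf{u},\mathsf{v}$, and let $F=(F_{ij})_{i,j\in\mathcal{S}}$ be a matrix of proper distribution functions on $\mathbb{R}$. Suppose that $\sum_{n\ge 1}q_{ii}^{(n)}=\infty$ for some $i\in\mathcal{S}$, that $\mu:=\sum_{i,j\in\mathcal{S}}\mathsf{u}_i q_{ij}\mathsf{v}_j\int x\,F_{ij}(dx)>0$, and that $Q\otimes F$ is nonarithmetic. Then any solution $Z\in\mathcal{C}_b$ to the equation $Z=(Q\otimes F)*Z$ equals $c\mathsf{v}$ for some $c\in\mathbb{R}$, i.e. $Z_i(t)=c\,\mathsf{v}_i$ for all $i\in\mathcal{S}$ and $t\in\mathbb{R}$.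
   Context: $\mathcal{S}=\{1,\dots,m\}$ for some $m\in\mathbb{N}$, or $\mathcal{S}=\mathbb{N}$. A matrix $Q=(q_{ij})_{i,j\in\mathcal{S}}$ is called quasi-stochastic if it is an irreducible nonnegative matrix with maximal eigenvalue $1$ for which there exist positive left and right eigenvectors $\mathsf{u}=(\mathsf{u}_i)_{i\in\mathcal{S}}$, $\mathsf{v}=(\mathsf{v}_i)_{i\in\mathcal{S}}$ (all entries strictly positive), unique up to scaling, i.e. $\mathsf{u}^\top Q=\mathsf{u}^\top$ and $Q\mathsf{v}=\mathsf{v}$. (For infinite $\mathcal{S}$, "maximal eigenvalue $1$" is understood to mean only that such positive eigenvectors for the eigenvalue $1$ exist and are unique up to scaling, so that e.g. every irreducible recurrent stochastic matrix is included.) Fix such $\mathsf{u},\mathsf{v}$. Write $Q^n=(q_{ij}^{(n)})$; all entries are finite. Distribution functions are identified with their probability measures, and $Q\otimes F(t):=(q_{ij}F_{ij}(t))_{i,j}$. The equation $Z=(Q\otimes F)*Z$ means $Z_i(t)=\sum_{j\in\mathcal{S}}q_{ij}\int_{\mathbb{R}}Z_j(t-x)\,F_{ij}(dx)$ for all $t\in\mathbb{R}$, $i\in\mathcal{S}$. In the definition of $\mu$ it is understood that the double sum/integral is well-defined (possibly $+\infty$), i.e. $\sum_{i,j}\mathsf{u}_iq_{ij}\mathsf{v}_j\int x^{-}F_{ij}(dx)<\infty$ or the same with $x^+$. $Q\otimes F$ is called $d$-arithmetic if $d$ is the maximal positive number such that, for some function $\gamma:\mathcal{S}\to[0,d)$,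 $F_{ij}(\gamma(j)-\gamma(i)+d\mathbb{Z})=1$ for all $i,j\in\mathcal{S}$ with $\mathsf{u}_iq_{ij}\mathsf{v}_j>0$. If no such $d$ exists, $Q\otimes F$ is called nonarithmetic. $\mathcal{C}_b$ is the class of all $Z:\mathcal{S}\times\mathbb{R}\to\mathbb{R}$, $Z_i:=Z(i,\cdot)$, such that $\sup_{i\in\mathcal{S}}\sup_{t\in\mathbb{R}}\mathsf{v}_i^{-1}|Z_i(t)|<\infty$ and $Z_i$ is continuous for all $i\in\mathcal{S}$. *)

theory Defs
  imports "HOL-Probability.Probability"
begin

text \<open>Index sets are sets of natural numbers; a matrix is a function of two indices of which only
  the values on the index set matter. The natural numbers of the source start at 1.\<close>

definition index_set :: "nat set \<Rightarrow> bool" where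
  "index_set S \<longleftrightarrow> (\<exists>m\<ge>1. S = {1..m}) \<or> S = {1..}"

text \<open>For nonnegative \<open>Q\<close>; taken in the extended nonnegative reals so that the defining (possibly
  infinite) sums always exist.\<close>

primrec mat_pow :: "nat set \<Rightarrow> (nat \<Rightarrow> nat \<Rightarrow> real) \<Rightarrow> nat \<Rightarrow> nat \<Rightarrow> nat \<Rightarrow> ennreal" where
  "mat_pow S Q 0 i j = (if i = j then 1 else 0)"
| "mat_pow S Q (Suc n) i j = (\<Sum>\<^sub>\<infinity>k\<in>S. ennreal (Q i k) * mat_pow S Q n k j)"

definition irreducible_mat :: "nat set \<Rightarrow> (nat \<Rightarrow> nat \<Rightarrow> real) \<Rightarrow> bool" where
  "irreducible_mat S Q \<longleftrightarrow> (\<forall>i\<in>S. \<forall>j\<in>S. \<exists>n\<ge>1. mat_pow S Q n i j > 0)"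

definition pos_left_eigenvector ::
    "nat set \<Rightarrow> (nat \<Rightarrow> nat \<Rightarrow> real) \<Rightarrow> (nat \<Rightarrow> real) \<Rightarrow> bool" where
  "pos_left_eigenvector S Q u \<longleftrightarrow>
     (\<forall>i\<in>S. u i > 0) \<and> (\<forall>j\<in>S. ((\<lambda>i. u i * Q i j) has_sum u j) S)"

definition pos_right_eigenvector ::
    "nat set \<Rightarrow> (nat \<Rightarrow> nat \<Rightarrow> real) \<Rightarrow> (nat \<Rightarrow> real) \<Rightarrow> bool" where
  "pos_right_eigenvector S Q v \<longleftrightarrow>
     (\<forall>i\<in>S. v i > 0) \<and> (\<forall>i\<in>S. ((\<lambda>j. Q i j * v j) has_sum v i) S)"

text \<open>Complex eigenvalues, for a finite index set only.\<close>

definition eigenvalue_on :: "nat set \<Rightarrow> (nat \<Rightarrow> nat \<Rightarrow> real) \<Rightarrow> complex \<Rightarrow> bool" where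
  "eigenvalue_on S Q l \<longleftrightarrow>
     (\<exists>x :: nat \<Rightarrow> complex. (\<exists>i\<in>S. x i \<noteq> 0) \<and>
        (\<forall>i\<in>S. (\<Sum>j\<in>S. complex_of_real (Q i j) * x j) = l * x i))"

text \<open>For infinite \<open>S\<close>, having maximal eigenvalue 1 means no more than the existence and uniqueness
  of the positive eigenvectors. Uniqueness is among positive eigenvectors.\<close>

definition quasi_stochastic :: "nat set \<Rightarrow> (nat \<Rightarrow> nat \<Rightarrow> real) \<Rightarrow> bool" where
  "quasi_stochastic S Q \<longleftrightarrow>
     (\<forall>i\<in>S. \<forall>j\<in>S. Q i j \<ge> 0) \<and>
     irreducible_mat S Q \<and>
     (finite S \<longrightarrow> eigenvalue_on S Q 1 \<and> (\<forall>l. eigenvalue_on S Q l \<longrightarrow> cmod l \<le> 1)) \<and>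
     (\<exists>u. pos_left_eigenvector S Q u) \<and>
     (\<exists>v. pos_right_eigenvector S Q v) \<and>
     (\<forall>u u'. pos_left_eigenvector S Q u \<longrightarrow> pos_left_eigenvector S Q u' \<longrightarrow>
        (\<exists>c. \<forall>i\<in>S. u' i = c * u i)) \<and>
     (\<forall>v v'. pos_right_eigenvector S Q v \<longrightarrow> pos_right_eigenvector S Q v' \<longrightarrow>
        (\<exists>c. \<forall>i\<in>S. v' i = c * v i))"

text \<open>As \<open>ennreal\<close> maps negative reals to 0, the integrals below are those of the positive and the
  negative part of \<open>x\<close>. The drift \<open>drift\<close> is meaningful only under \<open>drift_well_defined\<close>.\<close>

definition drift_pos :: "nat set \<Rightarrow> (nat \<Rightarrow> nat \<Rightarrow> real) \<Rightarrow> (nat \<Rightarrow> nat \<Rightarrow> real measure) \<Rightarrow>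
    (nat \<Rightarrow> real) \<Rightarrow> (nat \<Rightarrow> real) \<Rightarrow> ennreal" where
  "drift_pos S Q F u v =
     (\<Sum>\<^sub>\<infinity>(i, j)\<in>S \<times> S. ennreal (u i * Q i j * v j) * (\<integral>\<^sup>+x. ennreal x \<partial>F i j))"

definition drift_neg :: "nat set \<Rightarrow> (nat \<Rightarrow> nat \<Rightarrow> real) \<Rightarrow> (nat \<Rightarrow> nat \<Rightarrow> real measure) \<Rightarrow>
    (nat \<Rightarrow> real) \<Rightarrow> (nat \<Rightarrow> real) \<Rightarrow> ennreal" where
  "drift_neg S Q F u v =
     (\<Sum>\<^sub>\<infinity>(i, j)\<in>S \<times> S. ennreal (u i * Q i j * v j) * (\<integral>\<^sup>+x. ennreal (- x) \<partial>F i j))"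

definition drift_well_defined :: "nat set \<Rightarrow> (nat \<Rightarrow> nat \<Rightarrow> real) \<Rightarrow>
    (nat \<Rightarrow> nat \<Rightarrow> real measure) \<Rightarrow> (nat \<Rightarrow> real) \<Rightarrow> (nat \<Rightarrow> real) \<Rightarrow> bool" where
  "drift_well_defined S Q F u v \<longleftrightarrow> drift_neg S Q F u v < \<infinity> \<or> drift_pos S Q F u v < \<infinity>"

definition drift :: "nat set \<Rightarrow> (nat \<Rightarrow> nat \<Rightarrow> real) \<Rightarrow> (nat \<Rightarrow> nat \<Rightarrow> real measure) \<Rightarrow>
    (nat \<Rightarrow> real) \<Rightarrow> (nat \<Rightarrow> real) \<Rightarrow> ereal" where
  "drift S Q F u v = enn2ereal (drift_pos S Q F u v) - enn2ereal (drift_neg S Q F u v)"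

definition lattice_admissible :: "nat set \<Rightarrow> (nat \<Rightarrow> nat \<Rightarrow> real) \<Rightarrow>
    (nat \<Rightarrow> nat \<Rightarrow> real measure) \<Rightarrow> (nat \<Rightarrow> real) \<Rightarrow> (nat \<Rightarrow> real) \<Rightarrow> real \<Rightarrow> bool" where
  "lattice_admissible S Q F u v d \<longleftrightarrow>
     d > 0 \<and> (\<exists>\<gamma> :: nat \<Rightarrow> real. (\<forall>i\<in>S. \<gamma> i \<in> {0..<d}) \<and>
       (\<forall>i\<in>S. \<forall>j\<in>S. u i * Q i j * v j > 0 \<longrightarrow>
          measure (F i j) (range (\<lambda>k :: int. \<gamma> j - \<gamma> i + d * of_int k)) = 1))"

definition d_arithmetic :: "nat set \<Rightarrow> (nat \<Rightarrow> nat \<Rightarrow> real) \<Rightarrow>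
    (nat \<Rightarrow> nat \<Rightarrow> real measure) \<Rightarrow> (nat \<Rightarrow> real) \<Rightarrow> (nat \<Rightarrow> real) \<Rightarrow> real \<Rightarrow> bool" where
  "d_arithmetic S Q F u v d \<longleftrightarrow>
     lattice_admissible S Q F u v d \<and> (\<forall>d'. lattice_admissible S Q F u v d' \<longrightarrow> d' \<le> d)"

definition nonarithmetic :: "nat set \<Rightarrow> (nat \<Rightarrow> nat \<Rightarrow> real) \<Rightarrow>
    (nat \<Rightarrow> nat \<Rightarrow> real measure) \<Rightarrow> (nat \<Rightarrow> real) \<Rightarrow> (nat \<Rightarrow> real) \<Rightarrow> bool" where
  "nonarithmetic S Q F u v \<longleftrightarrow> (\<nexists>d. d_arithmetic S Q F u v d)"

definition Cb :: "nat set \<Rightarrow> (nat \<Rightarrow> real) \<Rightarrow> (nat \<Rightarrow> real \<Rightarrow> real) set" where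
  "Cb S v = {Z. bdd_above ((\<lambda>(i, t). inverse (v i) * \<bar>Z i t\<bar>) ` (S \<times> UNIV)) \<and>
               (\<forall>i\<in>S. continuous_on UNIV (Z i))}"

text \<open>The equation \<open>Z = (Q \<otimes> F) * Z\<close>. It is used for members of \<open>Cb\<close> only, where every integrand
  is bounded and continuous and hence integrable.\<close>

definition solves_renewal :: "nat set \<Rightarrow> (nat \<Rightarrow> nat \<Rightarrow> real) \<Rightarrow>
    (nat \<Rightarrow> nat \<Rightarrow> real measure) \<Rightarrow> (nat \<Rightarrow> real \<Rightarrow> real) \<Rightarrow> bool" where
  "solves_renewal S Q F Z \<longleftrightarrow>
     (\<forall>i\<in>S. \<forall>t. ((\<lambda>j. Q i j * (\<integral>x. Z j (t - x) \<partial>F i j)) has_sum Z i t) S)"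

end

theory Submission
  imports Defs
begin

text \<open>
  Dividing by \<open>v\<close> turns \<open>Q\<close> into a recurrent stochastic kernel \<open>K\<close> with invariant weights \<open>\<pi> i = u i * v i\<close>, and \<open>Z\<close>,
  up to an additive constant, into a bounded nonnegative function \<open>z\<close> harmonic for the operator \<open>T\<close> of the
  Markov random walk.

  Since \<open>T\<^sup>n z\<^sup>2\<close> is increasing and bounded, \<open>\<Sum>n. T\<^sup>n (T\<^sup>m z\<^sup>2 - z\<^sup>2)\<close> is finite. For a law \<open>\<nu>\<close> of displacements along a
  cycle at \<open>i\<close> it follows by Fubini that, for \<open>\<nu>\<close>-almost every \<open>x\<close>, the subharmonic function
  \<open>\<phi> j t = (z j t - z j (t - x))\<^sup>2\<close>, restricted to state \<open>i\<close>, has a finite potential; by recurrence this forces \<open>\<phi> i t = 0\<close>.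
  So all cycle displacements are periods of \<open>z i\<close>.

  The periods form a closed subgroup of the reals. If it is everything, \<open>z i\<close> is constant, and \<open>z\<close> does not depend on
  \<open>i\<close> by recurrence. If it is \<open>d\<int>\<close>, then \<open>d\<close> is admissible as a lattice span. As there is no largest span, the spans then
  have no maximum, which is possible only if all cycle displacements vanish. Then the displacements are
  increments \<open>g j - g i\<close> of a potential, and comparing the drift with the bounded sums of clamped increments along the
  recurrent chain shows that it is not positive.
\<close>

subsection \<open>Superharmonic functions of recurrent kernels\<close>

text \<open>The definitions sum with \<open>infsum\<close>, while Tonelli, Fatou and monotone
  convergence are available for integrals. Both sides are suprema of finite partial sums; in the
  infinite case an enumeration of \<open>A\<close> turns the integral into a series.\<close>

lemma nn_integral_count_space_infsum:
  fixes f :: "'a \<Rightarrow> ennreal"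
  assumes "countable A"
  shows "(\<integral>\<^sup>+x. f x \<partial>count_space A) = infsum f A"
proof (rule antisym)
  have inf: "infsum f A = (SUP F\<in>{F. finite F \<and> F \<subseteq> A}. sum f F)"
    by (rule nonneg_infsum_complete) simp
  show "infsum f A \<le> (\<integral>\<^sup>+x. f x \<partial>count_space A)"
    unfolding inf
  proof (rule SUP_least)
    fix F assume "F \<in> {F. finite F \<and> F \<subseteq> A}"
    then have F: "finite F" "F \<subseteq> A" by auto
    have "sum f F = (\<integral>\<^sup>+x. f x * indicator F x \<partial>count_space A)"
      using F by (subst nn_integral_count_space'[where A=F]) (auto intro!: sum.cong)
    also have "\<dots> \<le> (\<integral>\<^sup>+x. f x \<partial>count_space A)"
      by (intro nn_integral_mono) (auto split: split_indicator)
    finally show "sum f F \<le> (\<integral>\<^sup>+x. f x \<partial>count_space A)" .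
  qed
  show "(\<integral>\<^sup>+x. f x \<partial>count_space A) \<le> infsum f A"
  proof (cases "finite A")
    case True
    then show ?thesis by (simp add: nn_integral_count_space_finite)
  next
    case False
    have bij: "bij_betw (from_nat_into A) UNIV A"
      using bij_betw_from_nat_into[OF assms False] .
    have "(\<integral>\<^sup>+x. f x \<partial>count_space A) = (\<Sum>n. f (from_nat_into A n))"
      by (simp add: nn_integral_bij_count_space[symmetric, OF bij] nn_integral_count_space_nat)
    also have "\<dots> \<le> infsum f A"
    proof (rule suminf_le_const[OF summableI])
      fix n
      have "(\<Sum>k<n. f (from_nat_into A k)) = sum f (from_nat_into A ` {..<n})"
        using bij by (subst sum.reindex) (auto simp: bij_betw_def inj_on_def)
      also have "\<dots> \<le> infsum f A"
        unfolding inf using bij by (intro SUP_upper) (auto simp: bij_betw_def)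
      finally show "(\<Sum>k<n. f (from_nat_into A k)) \<le> infsum f A" .
    qed
    finally show ?thesis .
  qed
qed

section \<open>Powers of a nonnegative kernel as operators on functions\<close>

definition kop :: "nat set \<Rightarrow> (nat \<Rightarrow> nat \<Rightarrow> ennreal) \<Rightarrow> (nat \<Rightarrow> ennreal) \<Rightarrow> nat \<Rightarrow> ennreal" where
  "kop S K f i = (\<integral>\<^sup>+j. K i j * f j \<partial>count_space S)"

lemma kop_mono: "(\<And>j. j \<in> S \<Longrightarrow> f j \<le> g j) \<Longrightarrow> kop S K f i \<le> kop S K g i"
  unfolding kop_def by (intro nn_integral_mono mult_left_mono) auto

lemma kop_cong: "(\<And>j. j \<in> S \<Longrightarrow> f j = g j) \<Longrightarrow> kop S K f i = kop S K g i"
  unfolding kop_def by (intro nn_integral_cong) auto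

lemma kop_add: "kop S K (\<lambda>j. f j + g j) i = kop S K f i + kop S K g i"
  unfolding kop_def by (simp add: distrib_left nn_integral_add)

lemma kop_cmult: "kop S K (\<lambda>j. c * f j) i = c * kop S K f i"
  unfolding kop_def by (subst nn_integral_cmult[symmetric]) (auto simp: mult_ac)

lemma kop_sum: "kop S K (\<lambda>j. \<Sum>a\<in>B. f a j) i = (\<Sum>a\<in>B. kop S K (f a) i)"
  unfolding kop_def by (simp add: sum_distrib_left nn_integral_sum)

lemma kop_pow_mono:
  "(\<And>j. j \<in> S \<Longrightarrow> f j \<le> g j) \<Longrightarrow> i \<in> S \<Longrightarrow> (kop S K ^^ n) f i \<le> (kop S K ^^ n) g i"
  by (induction n arbitrary: i) (auto intro: kop_mono)

lemma kop_pow_cmult: "(kop S K ^^ n) (\<lambda>j. c * f j) i = c * (kop S K ^^ n) f i"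
proof (induction n arbitrary: i)
  case (Suc n)
  have "(kop S K ^^ n) (\<lambda>j. c * f j) = (\<lambda>i. c * (kop S K ^^ n) f i)"
    using Suc.IH by blast
  then show ?case by (simp add: kop_cmult)
qed simp

text \<open>The entry \<open>(i, j)\<close> of the \<open>n\<close>-th matrix power is \<open>(kop S K ^^ n) (indicator {j}) i\<close>.\<close>

lemma kop_pow_ge:
  assumes "i \<in> S" "k \<in> S"
  shows "(kop S K ^^ n) (indicator {k}) i * f k \<le> (kop S K ^^ n) f i"
proof -
  have "(kop S K ^^ n) (indicator {k}) i * f k = (kop S K ^^ n) (\<lambda>j. f k * indicator {k} j) i"
    by (simp add: kop_pow_cmult mult.commute)
  also have "\<dots> \<le> (kop S K ^^ n) f i"
    using assms by (intro kop_pow_mono) (auto split: split_indicator)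
  finally show ?thesis .
qed

text \<open>Divergence of the expected number of visits is asked at one state only; irreducibility
  spreads it. The exponent \<open>n = 0\<close> is allowed in the irreducibility condition.\<close>

locale recurrent_kernel =
  fixes S :: "nat set" and K :: "nat \<Rightarrow> nat \<Rightarrow> ennreal"
  assumes total: "\<And>i. i \<in> S \<Longrightarrow> kop S K (\<lambda>_. 1) i = 1"
    and irreducible: "\<And>i j. i \<in> S \<Longrightarrow> j \<in> S \<Longrightarrow> \<exists>n. (kop S K ^^ n) (indicator {j}) i > 0"
    and recurrent: "\<exists>i\<in>S. (\<Sum>n. (kop S K ^^ n) (indicator {i}) i) = \<infinity>"
begin

lemma kop_const: "i \<in> S \<Longrightarrow> kop S K (\<lambda>_. c) i = c"
  using kop_cmult[of S K c "\<lambda>_. 1" i] by (simp add: total)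

text \<open>A strict defect \<open>d\<close> at \<open>j\<close> is collected at every visit to
  \<open>j\<close>. The expected total stays below the finite value of \<open>f\<close> at the
  starting point, whereas recurrence makes it infinite.\<close>

lemma superharmonic_imp_harmonic:
  assumes fin: "\<And>i. i \<in> S \<Longrightarrow> f i < \<infinity>"
    and super: "\<And>i. i \<in> S \<Longrightarrow> kop S K f i \<le> f i"
    and j: "j \<in> S"
  shows "kop S K f j = f j"
proof (rule ccontr)
  assume "kop S K f j \<noteq> f j"
  then have lt: "kop S K f j < f j"
    using super[OF j] by simp
  define d where "d = f j - kop S K f j"
  have d0: "d > 0"
    using lt by (simp add: d_def diff_gt_0_iff_gt_ennreal)
  have step: "d * indicator {j} i + kop S K f i \<le> f i" if "i \<in> S" for i
    using super[OF that] lt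
    by (cases "i = j") (auto simp: d_def diff_add_cancel_ennreal)
  \<comment> \<open>Iterating \<open>step\<close> shows that the partial potentials of the defect,
    together with the remainder \<open>(kop S K ^^ n) f\<close>, never exceed
    \<open>f\<close>.\<close>
  have bound: "(\<Sum>k<n. (kop S K ^^ k) (\<lambda>a. d * indicator {j} a) i) + (kop S K ^^ n) f i \<le> f i"
    if "i \<in> S" for i n
    using that
  proof (induction n arbitrary: i)
    case (Suc n)
    have "(\<Sum>k<Suc n. (kop S K ^^ k) (\<lambda>a. d * indicator {j} a) i) + (kop S K ^^ Suc n) f i
      = d * indicator {j} i + kop S K (\<lambda>i. (\<Sum>k<n. (kop S K ^^ k) (\<lambda>a. d * indicator {j} a) i)
          + (kop S K ^^ n) f i) i"
      by (simp add: sum.lessThan_Suc_shift kop_add kop_sum add_ac del: sum.lessThan_Suc)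
    also have "\<dots> \<le> d * indicator {j} i + kop S K f i"
      using Suc.IH by (intro add_left_mono kop_mono) auto
    also have "\<dots> \<le> f i" by (rule step) fact
    finally show ?case .
  qed simp
  obtain r where r: "r \<in> S" "(\<Sum>n. (kop S K ^^ n) (indicator {r}) r) = \<infinity>"
    using recurrent by auto
  obtain m where m: "(kop S K ^^ m) (indicator {j}) r > 0"
    using irreducible[OF r(1) j] by auto
  \<comment> \<open>Every visit to the recurrent state \<open>r\<close> is followed,
    \<open>m\<close> steps later, by an expected gain of \<open>?c\<close>. So the potential of the
    defect, started in \<open>r\<close>, is at least the number of visits to \<open>r\<close> times
    \<open>?c\<close>.\<close>
  let ?c = "d * (kop S K ^^ m) (indicator {j}) r"
  have "(\<Sum>n. (kop S K ^^ n) (indicator {r}) r) * ?c = (\<Sum>n. (kop S K ^^ n) (indicator {r}) r * ?c)"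
    by simp
  also have "\<dots> \<le> f r"
  proof (rule suminf_le_const[OF summableI])
    fix N
    have "(\<Sum>n<N. (kop S K ^^ n) (indicator {r}) r * ?c)
      \<le> (\<Sum>n<N. (kop S K ^^ (n + m)) (\<lambda>a. d * indicator {j} a) r)"
    proof (rule sum_mono)
      fix n
      have "(kop S K ^^ n) (indicator {r}) r * ?c
        = (kop S K ^^ n) (indicator {r}) r * (kop S K ^^ m) (\<lambda>a. d * indicator {j} a) r"
        by (simp add: kop_pow_cmult)
      also have "\<dots> \<le> (kop S K ^^ n) ((kop S K ^^ m) (\<lambda>a. d * indicator {j} a)) r"
        by (rule kop_pow_ge) fact+
      finally show "(kop S K ^^ n) (indicator {r}) r * ?c
        \<le> (kop S K ^^ (n + m)) (\<lambda>a. d * indicator {j} a) r"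
        by (simp add: funpow_add)
    qed
    also have "\<dots> = (\<Sum>n\<in>{m..<N+m}. (kop S K ^^ n) (\<lambda>a. d * indicator {j} a) r)"
      using sum.shift_bounds_nat_ivl[of "\<lambda>n. (kop S K ^^ n) (\<lambda>a. d * indicator {j} a) r" 0 m N]
      by (simp add: atLeast0LessThan)
    also have "\<dots> \<le> (\<Sum>n<N+m. (kop S K ^^ n) (\<lambda>a. d * indicator {j} a) r)"
      by (intro sum_mono2) auto
    also have "\<dots> \<le> (\<Sum>n<N+m. (kop S K ^^ n) (\<lambda>a. d * indicator {j} a) r) + (kop S K ^^ (N+m)) f r"
      by simp
    also have "\<dots> \<le> f r" by (rule bound) fact
    finally show "(\<Sum>n<N. (kop S K ^^ n) (indicator {r}) r * ?c) \<le> f r" .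
  qed
  finally have "(\<Sum>n. (kop S K ^^ n) (indicator {r}) r) * ?c \<le> f r" .
  moreover have "?c \<noteq> 0" using d0 m by auto
  ultimately have "f r = \<infinity>"
    using r(2) by (simp add: ennreal_top_mult top_unique)
  then show False using fin[OF r(1)] by simp
qed

text \<open>If \<open>f i < f j\<close>, truncating \<open>f\<close> at the level \<open>f j\<close>
  gives a superharmonic, hence harmonic, \<open>g\<close>. Then \<open>f j - g\<close> is
  nonnegative and harmonic, vanishes at \<open>j\<close> and is positive at \<open>i\<close>, which
  contradicts irreducibility.\<close>

lemma superharmonic_const:
  assumes fin: "\<And>i. i \<in> S \<Longrightarrow> f i < \<infinity>"
    and super: "\<And>i. i \<in> S \<Longrightarrow> kop S K f i \<le> f i"
    and ij: "i \<in> S" "j \<in> S"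
  shows "f i = f j"
proof -
  have "\<not> f i < f j" if ij: "i \<in> S" "j \<in> S" for i j
  proof
    assume lt: "f i < f j"
    define g where "g k = min (f k) (f j)" for k
    define h where "h k = f j - g k" for k
    have gle: "g k \<le> f j" for k by (simp add: g_def)
    have gfin: "g k < \<infinity>" for k using gle[of k] fin[OF ij(2)] by (rule le_less_trans)
    have gsuper: "kop S K g k \<le> g k" if "k \<in> S" for k
    proof -
      have "kop S K g k \<le> kop S K f k" "kop S K g k \<le> kop S K (\<lambda>_. f j) k"
        by (auto intro!: kop_mono simp: g_def)
      then show ?thesis
        using super[OF that] by (simp add: g_def kop_const[OF that])
    qed
    have gharm: "kop S K g k = g k" if "k \<in> S" for k
      using gfin gsuper that by (rule superharmonic_imp_harmonic)
    \<comment> \<open>Subtraction in \<open>ennreal\<close> is truncated, so harmonicity of the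
      difference is obtained by adding \<open>g\<close> back and cancelling its finite
      value.\<close>
    have hharm: "kop S K h k = h k" if "k \<in> S" for k
    proof -
      have "kop S K h k + g k = kop S K (\<lambda>k. h k + g k) k"
        using gharm[OF that] by (simp add: kop_add)
      also have "\<dots> = f j"
        using gle that by (simp add: h_def kop_const diff_add_cancel_ennreal)
      finally show ?thesis
        using gfin[of k] unfolding h_def
        by (metis ennreal_add_diff_cancel_right infinity_ennreal_def less_irrefl)
    qed
    have hpow: "(kop S K ^^ n) h k = h k" if "k \<in> S" for k n
      using that
    proof (induction n arbitrary: k)
      case (Suc n)
      have "(kop S K ^^ Suc n) h k = kop S K h k"
        using Suc.IH by (auto intro: kop_cong)
      then show ?case using hharm[OF Suc.prems] by simp
    qed simp
    obtain n where n: "(kop S K ^^ n) (indicator {i}) j > 0"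
      using irreducible[OF ij(2) ij(1)] by auto
    have "(kop S K ^^ n) (indicator {i}) j * h i \<le> h j"
      using kop_pow_ge[OF ij(2) ij(1), where K=K and n=n and f=h] hpow[OF ij(2)] by simp
    moreover have "h j = 0" using fin[OF ij(2)] by (simp add: h_def g_def)
    moreover have "h i > 0" using lt by (simp add: h_def g_def diff_gt_0_iff_gt_ennreal)
    ultimately show False using n by auto
  qed
  from this[OF ij] this[OF ij(2,1)] show ?thesis by simp
qed

text \<open>The complement \<open>C - f\<close> is superharmonic and finite, hence constant, and it
  equals \<open>C\<close> at \<open>i\<close>.\<close>

lemma bounded_subharmonic_zero:
  assumes fin: "C < \<infinity>" and bound: "\<And>i. i \<in> S \<Longrightarrow> f i \<le> C"
    and sub: "\<And>i. i \<in> S \<Longrightarrow> f i \<le> kop S K f i"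
    and ij: "i \<in> S" "j \<in> S" and zero: "f i = 0"
  shows "f j = 0"
proof -
  have "C - f i = C - f j"
  proof (rule superharmonic_const[OF _ _ ij])
    fix k assume k: "k \<in> S"
    show "C - f k < \<infinity>" using fin by (simp add: less_top[symmetric])
    have "kop S K (\<lambda>k. C - f k) k + kop S K f k = kop S K (\<lambda>k. C - f k + f k) k"
      by (simp add: kop_add)
    also have "\<dots> = kop S K (\<lambda>_. C) k" using bound by (intro kop_cong) (simp add: diff_add_cancel_ennreal)
    also have "\<dots> = C" using k by (rule kop_const)
    finally have "kop S K (\<lambda>k. C - f k) k + kop S K f k = C" .
    then have "kop S K (\<lambda>k. C - f k) k + f k \<le> C"
      using sub[OF k] by (metis add_left_mono)
    moreover have "f k < \<infinity>" using bound[OF k] fin by (rule le_less_trans)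
    ultimately show "kop S K (\<lambda>k. C - f k) k \<le> C - f k"
      by (metis add_diff_eq_ennreal ennreal_add_diff_cancel_right ennreal_minus_mono
          infinity_ennreal_def less_irrefl order_refl)
  qed
  then have "C = C - f j" using zero by simp
  then show ?thesis
    using fin bound[OF ij(2)] zero
    by (metis diff_add_cancel_ennreal ennreal_add_left_cancel add.right_neutral infinity_ennreal_def less_irrefl)
qed

end

subsection \<open>The operator of a Markov random walk\<close>

lemma borel_measurable_nn_integral_count_space_nat:
  fixes S :: "nat set"
  assumes "\<And>j. j \<in> S \<Longrightarrow> f j \<in> borel_measurable M"
  shows "(\<lambda>x. \<integral>\<^sup>+j. f j x \<partial>count_space S) \<in> borel_measurable M"
proof -
  have "(\<integral>\<^sup>+j. f j x \<partial>count_space S) = (\<Sum>j. f j x * indicator S j)" for x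
    by (simp add: nn_integral_count_space_indicator nn_integral_count_space_nat)
  moreover have "(\<lambda>x. f j x * indicator S j) \<in> borel_measurable M" for j
    using assms by (cases "j \<in> S") auto
  ultimately show ?thesis by simp
qed

text \<open>\<open>wop S K F f i t\<close> is the expectation of \<open>f M\<^sub>1 (t - X\<^sub>1)\<close> for the Markov random walk started in \<open>i\<close>.\<close>

definition wop :: "nat set \<Rightarrow> (nat \<Rightarrow> nat \<Rightarrow> ennreal) \<Rightarrow> (nat \<Rightarrow> nat \<Rightarrow> real measure) \<Rightarrow>
    (nat \<Rightarrow> real \<Rightarrow> ennreal) \<Rightarrow> nat \<Rightarrow> real \<Rightarrow> ennreal" where
  "wop S K F f i t = (\<integral>\<^sup>+j. K i j * (\<integral>\<^sup>+x. f j (t - x) \<partial>F i j) \<partial>count_space S)"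

locale recurrent_walk = recurrent_kernel +
  fixes F :: "nat \<Rightarrow> nat \<Rightarrow> real measure"
  assumes distr: "\<And>i j. i \<in> S \<Longrightarrow> j \<in> S \<Longrightarrow> real_distribution (F i j)"
begin

abbreviation "T \<equiv> wop S K F"

abbreviation "meas f \<equiv> (\<forall>j\<in>S. f j \<in> borel_measurable (borel :: real measure))"

lemma sets_F [measurable_cong]: "i \<in> S \<Longrightarrow> j \<in> S \<Longrightarrow> sets (F i j) = sets borel"
  using distr real_distribution.events_eq_borel by blast

lemma sigma_finite_F: "i \<in> S \<Longrightarrow> j \<in> S \<Longrightarrow> sigma_finite_measure (F i j)"
  using distr[of i j] prob_space_imp_sigma_finite real_distribution.axioms(1) by blast

lemma measurable_F: "i \<in> S \<Longrightarrow> j \<in> S \<Longrightarrow> borel_measurable (F i j) = borel_measurable borel"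
  by (intro measurable_cong_sets sets_F refl)

text \<open>Joint measurability in the time and a parameter is carried along because the parameter
  will be a random displacement, over which Fubini is applied.\<close>

lemma T_measurable_param:
  assumes f: "\<And>j. j \<in> S \<Longrightarrow> (\<lambda>(t, x). f j t x) \<in> borel_measurable (borel \<Otimes>\<^sub>M N)" and i: "i \<in> S"
  shows "(\<lambda>(t, x). T (\<lambda>j t. f j t x) i t) \<in> borel_measurable (borel \<Otimes>\<^sub>M N)"
  unfolding wop_def split_beta
proof (rule borel_measurable_nn_integral_count_space_nat)
  fix j assume j: "j \<in> S"
  interpret sigma_finite_measure "F i j" using i j by (rule sigma_finite_F)
  note [measurable_cong] = sets_F[OF i j]
  have [measurable]: "(\<lambda>q. f j (fst q) (snd q)) \<in> borel_measurable (borel \<Otimes>\<^sub>M N)"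
    using f[OF j] by (simp add: split_beta)
  have "(\<lambda>(p, y). f j (fst p - y) (snd p)) \<in> borel_measurable ((borel \<Otimes>\<^sub>M N) \<Otimes>\<^sub>M F i j)"
    using measurable_compose[of "\<lambda>(p, y). (fst p - y, snd p)" "(borel \<Otimes>\<^sub>M N) \<Otimes>\<^sub>M F i j" "borel \<Otimes>\<^sub>M N"
        "\<lambda>q. f j (fst q) (snd q)" borel]
    by (simp add: split_beta)
  then show "(\<lambda>p. K i j * (\<integral>\<^sup>+y. f j (fst p - y) (snd p) \<partial>F i j)) \<in> borel_measurable (borel \<Otimes>\<^sub>M N)"
    by (intro borel_measurable_times_ennreal borel_measurable_const borel_measurable_nn_integral)
qed

lemma T_pow_measurable_param:
  assumes "\<And>j. j \<in> S \<Longrightarrow> (\<lambda>(t, x). f j t x) \<in> borel_measurable (borel \<Otimes>\<^sub>M N)" and "i \<in> S"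
  shows "(\<lambda>(t, x). (T ^^ n) (\<lambda>j t. f j t x) i t) \<in> borel_measurable (borel \<Otimes>\<^sub>M N)"
  using assms(2)
proof (induction n arbitrary: i)
  case 0
  then show ?case using assms(1) by simp
next
  case (Suc n)
  then show ?case
    using T_measurable_param[of "\<lambda>j t x. (T ^^ n) (\<lambda>j t. f j t x) j t" N i] by simp
qed

lemma T_pow_measurable: "meas f \<Longrightarrow> meas ((T ^^ n) f)"
proof
  fix i assume f: "meas f" and i: "i \<in> S"
  \<comment> \<open>The parameter \<open>x\<close> is a dummy; it is set to 0 at the end.\<close>
  have "(\<lambda>(t, x :: real). (T ^^ n) f i t) \<in> borel_measurable (borel \<Otimes>\<^sub>M borel)"
  proof (rule T_pow_measurable_param[OF _ i])
    fix j assume "j \<in> S"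
    then have [measurable]: "f j \<in> borel_measurable borel" using f by blast
    show "(\<lambda>(t, x :: real). f j t) \<in> borel_measurable (borel \<Otimes>\<^sub>M borel)" by measurable
  qed
  then have "(\<lambda>p :: real \<times> real. (T ^^ n) f i (fst p)) \<in> borel_measurable (borel \<Otimes>\<^sub>M borel)"
    by (simp add: split_beta)
  from measurable_compose[OF _ this, of "\<lambda>t. (t, 0)" borel]
  show "(T ^^ n) f i \<in> borel_measurable borel" by simp
qed

lemma shift_measurable:
  "meas f \<Longrightarrow> i \<in> S \<Longrightarrow> j \<in> S \<Longrightarrow> (\<lambda>x. f j (t - x)) \<in> borel_measurable (F i j)"
  by (simp add: measurable_F measurable_compose[where f="\<lambda>x. t - x" and N=borel])

lemma T_mono: "(\<And>j t. j \<in> S \<Longrightarrow> f j t \<le> g j t) \<Longrightarrow> T f i t \<le> T g i t"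
  unfolding wop_def by (intro nn_integral_mono mult_left_mono) auto

lemma T_cong: "(\<And>j t. j \<in> S \<Longrightarrow> f j t = g j t) \<Longrightarrow> T f i t = T g i t"
  unfolding wop_def by (intro nn_integral_cong arg_cong2[where f="(*)"]) auto

lemma T_add: "meas f \<Longrightarrow> meas g \<Longrightarrow> i \<in> S \<Longrightarrow> T (\<lambda>j t. f j t + g j t) i t = T f i t + T g i t"
proof -
  assume m: "meas f" "meas g" and i: "i \<in> S"
  have "T (\<lambda>j t. f j t + g j t) i t
    = (\<integral>\<^sup>+j. K i j * (\<integral>\<^sup>+x. f j (t - x) \<partial>F i j) + K i j * (\<integral>\<^sup>+x. g j (t - x) \<partial>F i j) \<partial>count_space S)"
    unfolding wop_def using m i
    by (intro nn_integral_cong) (simp add: nn_integral_add shift_measurable distrib_left)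
  then show ?thesis by (simp add: wop_def nn_integral_add)
qed

lemma T_cmult: "meas f \<Longrightarrow> i \<in> S \<Longrightarrow> T (\<lambda>j t. c * f j t) i t = c * T f i t"
proof -
  assume m: "meas f" and i: "i \<in> S"
  have "T (\<lambda>j t. c * f j t) i t = (\<integral>\<^sup>+j. c * (K i j * (\<integral>\<^sup>+x. f j (t - x) \<partial>F i j)) \<partial>count_space S)"
    unfolding wop_def using m i
    by (intro nn_integral_cong) (simp add: nn_integral_cmult shift_measurable mult_ac)
  then show ?thesis by (simp add: wop_def nn_integral_cmult)
qed

lemma T_suminf:
  assumes m: "\<And>n. meas (f n)" and i: "i \<in> S"
  shows "T (\<lambda>j t. \<Sum>n. f n j t) i t = (\<Sum>n. T (f n) i t)"
proof -
  have "T (\<lambda>j t. \<Sum>n. f n j t) i t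
    = (\<integral>\<^sup>+j. (\<Sum>n. K i j * (\<integral>\<^sup>+x. f n j (t - x) \<partial>F i j)) \<partial>count_space S)"
    unfolding wop_def using m i
    by (intro nn_integral_cong) (simp add: nn_integral_suminf shift_measurable)
  also have "\<dots> = (\<Sum>n. \<integral>\<^sup>+j. K i j * (\<integral>\<^sup>+x. f n j (t - x) \<partial>F i j) \<partial>count_space S)"
    by (rule nn_integral_suminf) simp
  finally show ?thesis by (simp add: wop_def)
qed

text \<open>Each \<open>F i j\<close> has mass 1. This is the link through which recurrence of the
  kernel \<open>K\<close> alone acts on the walk.\<close>

lemma T_const_in_t: "i \<in> S \<Longrightarrow> T (\<lambda>j t. h j) i t = kop S K h i"
  unfolding wop_def kop_def
proof (intro nn_integral_cong)
  fix j assume "i \<in> S" "j \<in> space (count_space S)"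
  then interpret real_distribution "F i j" using distr by simp
  show "K i j * (\<integral>\<^sup>+x. h j \<partial>F i j) = K i j * h j"
    using emeasure_space_1 by simp
qed

lemma T_translate: "(T ^^ n) (\<lambda>j t. f j (t - x)) i t = (T ^^ n) f i (t - x)"
proof (induction n arbitrary: i t)
  case (Suc n)
  have "(T ^^ n) (\<lambda>j t. f j (t - x)) = (\<lambda>j t. (T ^^ n) f j (t - x))"
    using Suc.IH by blast
  moreover have "T (\<lambda>j t. g j (t - x)) i t = T g i (t - x)" for g
    by (simp add: wop_def diff_diff_eq add.commute)
  ultimately show ?case by simp
qed simp

lemma T_pow_mono:
  "(\<And>j t. j \<in> S \<Longrightarrow> f j t \<le> g j t) \<Longrightarrow> i \<in> S \<Longrightarrow> (T ^^ n) f i t \<le> (T ^^ n) g i t"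
  by (induction n arbitrary: i t) (auto intro: T_mono)

lemma T_pow_cong:
  "(\<And>j t. j \<in> S \<Longrightarrow> f j t = g j t) \<Longrightarrow> i \<in> S \<Longrightarrow> (T ^^ n) f i t = (T ^^ n) g i t"
  by (induction n arbitrary: i t) (auto intro: T_cong)

lemma T_pow_add:
  assumes m: "meas f" "meas g"
  shows "i \<in> S \<Longrightarrow> (T ^^ n) (\<lambda>j t. f j t + g j t) i t = (T ^^ n) f i t + (T ^^ n) g i t"
proof (induction n arbitrary: i t)
  case (Suc n)
  have "(T ^^ Suc n) (\<lambda>j t. f j t + g j t) i t = T (\<lambda>j t. (T ^^ n) f j t + (T ^^ n) g j t) i t"
    using Suc.IH by (auto intro: T_cong)
  then show ?case using Suc.prems m by (simp add: T_add T_pow_measurable)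
qed simp

lemma T_pow_cmult:
  assumes m: "meas f"
  shows "i \<in> S \<Longrightarrow> (T ^^ n) (\<lambda>j t. c * f j t) i t = c * (T ^^ n) f i t"
proof (induction n arbitrary: i t)
  case (Suc n)
  have "(T ^^ Suc n) (\<lambda>j t. c * f j t) i t = T (\<lambda>j t. c * (T ^^ n) f j t) i t"
    using Suc.IH by (auto intro: T_cong)
  then show ?case using Suc.prems m by (simp add: T_cmult T_pow_measurable)
qed simp

lemma T_pow_fixed:
  assumes "\<And>j t. j \<in> S \<Longrightarrow> T f j t = f j t"
  shows "i \<in> S \<Longrightarrow> (T ^^ n) f i t = f i t"
proof (induction n arbitrary: i t)
  case (Suc n)
  have "(T ^^ Suc n) f i t = T f i t"
    using Suc.IH by (auto intro: T_cong)
  then show ?case using Suc.prems assms by simp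
qed simp

lemma T_pow_const: "i \<in> S \<Longrightarrow> (T ^^ n) (\<lambda>_ _. c) i t = c"
  by (rule T_pow_fixed) (simp_all add: T_const_in_t kop_const)

lemma T_pow_subharmonic:
  assumes "\<And>j t. j \<in> S \<Longrightarrow> f j t \<le> T f j t"
  shows "i \<in> S \<Longrightarrow> f i t \<le> (T ^^ n) f i t"
proof (induction n arbitrary: i t)
  case (Suc n)
  have "f i t \<le> T f i t" using assms Suc.prems by simp
  also have "\<dots> \<le> (T ^^ Suc n) f i t" using Suc.IH by (auto intro: T_mono)
  finally show ?case .
qed simp

lemma T_pow_suminf:
  assumes m: "\<And>n. meas (f n)"
  shows "i \<in> S \<Longrightarrow> (T ^^ N) (\<lambda>j t. \<Sum>n. f n j t) i t = (\<Sum>n. (T ^^ N) (f n) i t)"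
proof (induction N arbitrary: i t)
  case (Suc N)
  have "(T ^^ Suc N) (\<lambda>j t. \<Sum>n. f n j t) i t = T (\<lambda>j t. \<Sum>n. (T ^^ N) (f n) j t) i t"
    using Suc.IH by (auto intro: T_cong)
  then show ?case using Suc.prems m by (simp add: T_suminf T_pow_measurable)
qed simp

text \<open>Tonelli twice: \<open>N\<close> is exchanged with the sum over \<open>j\<close>, then
  with each \<open>F i j\<close>.\<close>

lemma T_nn_integral:
  assumes f: "\<And>j. j \<in> S \<Longrightarrow> (\<lambda>(t, x). f j t x) \<in> borel_measurable (borel \<Otimes>\<^sub>M N)" and i: "i \<in> S"
    and N: "sigma_finite_measure N"
  shows "T (\<lambda>j t. \<integral>\<^sup>+x. f j t x \<partial>N) i t = (\<integral>\<^sup>+x. T (\<lambda>j t. f j t x) i t \<partial>N)"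
proof -
  have meas: "(\<lambda>(x, y). f j (t - y) x) \<in> borel_measurable (N \<Otimes>\<^sub>M F i j)" if j: "j \<in> S" for j
  proof -
    note [measurable_cong] = sets_F[OF i j]
    from measurable_compose[OF _ f[OF j], of "\<lambda>(x, y). (t - y, x)" "N \<Otimes>\<^sub>M F i j"]
    show ?thesis by (simp add: split_beta)
  qed
  have "(\<integral>\<^sup>+x. T (\<lambda>j t. f j t x) i t \<partial>N)
    = (\<integral>\<^sup>+j. (\<integral>\<^sup>+x. K i j * (\<integral>\<^sup>+y. f j (t - y) x \<partial>F i j) \<partial>N) \<partial>count_space S)"
    unfolding wop_def
  proof (rule nn_integral_count_space_nn_integral)
    fix j assume j: "j \<in> S"
    interpret sigma_finite_measure "F i j" using i j by (rule sigma_finite_F)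
    show "(\<lambda>x. K i j * (\<integral>\<^sup>+y. f j (t - y) x \<partial>F i j)) \<in> borel_measurable N"
      using meas[OF j] by (intro borel_measurable_times_ennreal borel_measurable_const borel_measurable_nn_integral)
  qed simp
  also have "\<dots> = (\<integral>\<^sup>+j. K i j * (\<integral>\<^sup>+y. (\<integral>\<^sup>+x. f j (t - y) x \<partial>N) \<partial>F i j) \<partial>count_space S)"
  proof (rule nn_integral_cong)
    fix j assume "j \<in> space (count_space S)"
    then have j: "j \<in> S" by simp
    interpret pair_sigma_finite N "F i j"
      using N sigma_finite_F[OF i j] by (simp add: pair_sigma_finite_def)
    have "(\<lambda>x. \<integral>\<^sup>+y. f j (t - y) x \<partial>F i j) \<in> borel_measurable N"
      using meas[OF j] by (rule M2.borel_measurable_nn_integral)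
    then have "(\<integral>\<^sup>+x. K i j * (\<integral>\<^sup>+y. f j (t - y) x \<partial>F i j) \<partial>N)
      = K i j * (\<integral>\<^sup>+x. (\<integral>\<^sup>+y. f j (t - y) x \<partial>F i j) \<partial>N)"
      by (rule nn_integral_cmult)
    also have "(\<integral>\<^sup>+x. (\<integral>\<^sup>+y. f j (t - y) x \<partial>F i j) \<partial>N) = (\<integral>\<^sup>+y. (\<integral>\<^sup>+x. f j (t - y) x \<partial>N) \<partial>F i j)"
      using Fubini'[OF meas[OF j]] by simp
    finally show "(\<integral>\<^sup>+x. K i j * (\<integral>\<^sup>+y. f j (t - y) x \<partial>F i j) \<partial>N)
      = K i j * (\<integral>\<^sup>+y. (\<integral>\<^sup>+x. f j (t - y) x \<partial>N) \<partial>F i j)" .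
  qed
  finally show ?thesis by (simp add: wop_def)
qed

lemma T_pow_nn_integral:
  assumes f: "\<And>j. j \<in> S \<Longrightarrow> (\<lambda>(t, x). f j t x) \<in> borel_measurable (borel \<Otimes>\<^sub>M N)"
    and N: "sigma_finite_measure N"
  shows "i \<in> S \<Longrightarrow> (T ^^ n) (\<lambda>j t. \<integral>\<^sup>+x. f j t x \<partial>N) i t = (\<integral>\<^sup>+x. (T ^^ n) (\<lambda>j t. f j t x) i t \<partial>N)"
proof (induction n arbitrary: i t)
  case (Suc n)
  have "(T ^^ Suc n) (\<lambda>j t. \<integral>\<^sup>+x. f j t x \<partial>N) i t
    = T (\<lambda>j t. \<integral>\<^sup>+x. (T ^^ n) (\<lambda>j t. f j t x) j t \<partial>N) i t"
    using Suc.IH by (auto intro: T_cong)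
  also have "\<dots> = (\<integral>\<^sup>+x. T (\<lambda>j t. (T ^^ n) (\<lambda>j t. f j t x) j t) i t \<partial>N)"
    using f Suc.prems N by (intro T_nn_integral T_pow_measurable_param)
  finally show ?case by simp
qed simp

text \<open>With \<open>w\<close> the potential of \<open>1\<^sub>i \<phi>\<close>, the function \<open>\<beta> j = sup\<^sub>t (\<phi> j t - w j t)\<close> is bounded, subharmonic for
  the recurrent kernel \<open>K\<close> and zero at \<open>i\<close>. Hence \<open>\<phi> \<le> w\<close>, so that \<open>\<phi> \<le> T\<^sup>n w\<close>, a tail of the series \<open>w\<close>.\<close>

lemma subharmonic_zero:
  assumes i: "i \<in> S" and m: "meas \<phi>" and C: "C < \<infinity>"
    and bound: "\<And>j t. j \<in> S \<Longrightarrow> \<phi> j t \<le> C"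
    and sub: "\<And>j t. j \<in> S \<Longrightarrow> \<phi> j t \<le> T \<phi> j t"
    and fin: "(\<Sum>n. (T ^^ n) (\<lambda>j t. if j = i then \<phi> j t else 0) i t) < \<infinity>"
  shows "\<phi> i t = 0"
proof -
  define \<phi>' where "\<phi>' j t = (if j = i then \<phi> j t else 0)" for j t
  define w where "w j t = (\<Sum>n. (T ^^ n) \<phi>' j t)" for j t
  define \<beta> where "\<beta> j = (SUP t. \<phi> j t - w j t)" for j
  have m': "meas \<phi>'"
  proof
    fix j assume "j \<in> S"
    then show "\<phi>' j \<in> borel_measurable borel" using m by (cases "j = i") (auto simp: \<phi>'_def[abs_def])
  qed
  have mw: "meas w"
  proof
    fix j assume "j \<in> S"
    then have "(T ^^ n) \<phi>' j \<in> borel_measurable borel" for n using T_pow_measurable[OF m'] by blast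
    then show "w j \<in> borel_measurable borel" unfolding w_def[abs_def] by (intro borel_measurable_suminf_order)
  qed
  \<comment> \<open>Applying \<open>T\<close> to the power \<open>N\<close> deletes the first
    \<open>N\<close> terms of the series \<open>w\<close>; the identity is written additively to
    avoid subtraction.\<close>
  have Tw: "(T ^^ N) w j s + (\<Sum>n<N. (T ^^ n) \<phi>' j s) = w j s" if "j \<in> S" for N j s
  proof -
    have "(T ^^ N) w j s = (\<Sum>n. (T ^^ N) ((T ^^ n) \<phi>') j s)"
      unfolding w_def using m' that by (intro T_pow_suminf T_pow_measurable)
    also have "\<dots> = (\<Sum>n. (T ^^ (n + N)) \<phi>' j s)"
      by (simp add: funpow_add[symmetric] add.commute flip: comp_apply[of "T ^^ _" "T ^^ _"])
    finally show ?thesis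
      unfolding w_def by (subst suminf_offset[of _ N]) auto
  qed
  have le: "\<phi> j s \<le> w j s + \<beta> j" if "j \<in> S" for j s
  proof -
    have "\<phi> j s - w j s \<le> \<beta> j" unfolding \<beta>_def by (rule SUP_upper) simp
    then show ?thesis by (simp add: ennreal_minus_le_iff)
  qed
  have \<beta>0: "\<beta> j = 0" if j: "j \<in> S" for j
  proof (rule bounded_subharmonic_zero[OF C _ _ i j])
    show "\<beta> j \<le> C" if "j \<in> S" for j
      unfolding \<beta>_def using bound[OF that] by (intro SUP_least) (meson diff_le_self_ennreal order_trans)
    \<comment> \<open>The term \<open>n = 0\<close> of \<open>w i\<close> is already
      \<open>\<phi> i\<close>.\<close>
    show "\<beta> i = 0"
    proof -
      have "\<phi> i s \<le> w i s" for s
        using Tw[OF i, of 1 s] by (simp add: \<phi>'_def) (metis add.commute le_iff_add)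
      then have "\<phi> i s - w i s = 0" for s
        using bound[OF i, of s] C by (simp add: diff_eq_0_iff_ennreal le_less_trans)
      then show ?thesis by (simp add: \<beta>_def)
    qed
    \<comment> \<open>One step of the walk is applied to \<open>\<phi> \<le> w + \<beta>\<close>,
      using that \<open>T w \<le> w\<close>.\<close>
    show "\<beta> j \<le> kop S K \<beta> j" if j: "j \<in> S" for j
      unfolding \<beta>_def
    proof (rule SUP_least, fold \<beta>_def)
      fix s
      have "\<phi> j s \<le> T \<phi> j s" using sub j .
      also have "\<dots> \<le> T (\<lambda>k s. w k s + \<beta> k) j s" using le by (intro T_mono)
      also have "\<dots> = T w j s + kop S K \<beta> j"
        using j mw by (simp add: T_add T_const_in_t)
      also have "\<dots> \<le> w j s + kop S K \<beta> j"
        using Tw[OF j, of 1 s] by (intro add_right_mono) (simp, metis le_iff_add)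
      finally have *: "\<phi> j s \<le> w j s + kop S K \<beta> j" .
      have "\<phi> j s < \<infinity>" using bound[OF j] C by (rule le_less_trans)
      then show "\<phi> j s - w j s \<le> kop S K \<beta> j" using * by (auto simp: ennreal_minus_le_iff)
    qed
  qed
  \<comment> \<open>Adding the first \<open>N\<close> terms to the bound by the tail makes the right
    side independent of \<open>N\<close>. The limit gives \<open>\<phi> + w \<le> w\<close> at
    \<open>(i, t)\<close>, and the finite \<open>w i t\<close> cancels.\<close>
  have "\<phi> i t + (\<Sum>n<N. (T ^^ n) \<phi>' i t) \<le> w i t" for N
  proof -
    have "\<phi> i t \<le> (T ^^ N) \<phi> i t" using sub i by (rule T_pow_subharmonic)
    also have "\<dots> \<le> (T ^^ N) w i t"
      using le \<beta>0 i by (intro T_pow_mono) (metis add.right_neutral)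
    finally show ?thesis using Tw[OF i, of N t] by (metis add_right_mono)
  qed
  moreover have "(\<lambda>N. \<phi> i t + (\<Sum>n<N. (T ^^ n) \<phi>' i t)) \<longlonglongrightarrow> \<phi> i t + w i t"
    unfolding w_def by (intro tendsto_add tendsto_const summable_LIMSEQ summableI)
  ultimately have "\<phi> i t + w i t \<le> w i t"
    by (intro LIMSEQ_le_const2) auto
  moreover have "w i t < \<infinity>" using fin by (simp add: w_def \<phi>'_def[abs_def])
  ultimately show ?thesis
    by (metis add.commute add.right_neutral ennreal_add_left_cancel_le infinity_ennreal_def le_zero_eq less_irrefl)
qed

end

subsection \<open>Cycle displacements are periods\<close>

text \<open>\<open>\<nu>\<close> is, up to a positive factor, part of the law of the displacement of the walk on the event that
  it moves from \<open>i\<close> to \<open>j\<close> in \<open>m\<close> steps. This avoids path spaces and mixtures of the \<open>F i j\<close>.\<close>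

definition shift_bound :: "nat set \<Rightarrow> (nat \<Rightarrow> nat \<Rightarrow> ennreal) \<Rightarrow> (nat \<Rightarrow> nat \<Rightarrow> real measure) \<Rightarrow>
    nat \<Rightarrow> nat \<Rightarrow> nat \<Rightarrow> real measure \<Rightarrow> bool" where
  "shift_bound S K F m i j \<nu> \<longleftrightarrow> real_distribution \<nu> \<and>
     (\<exists>c>0. \<forall>f t. (\<forall>j\<in>S. f j \<in> borel_measurable borel) \<longrightarrow>
       c * (\<integral>\<^sup>+x. f j (t - x) \<partial>\<nu>) \<le> (wop S K F ^^ m) f i t)"

lemma ennreal_add_right_cancel:
  fixes a b c :: ennreal
  assumes "c \<noteq> \<top>" "a + c = b + c"
  shows "a = b"
proof -
  have "c + a = c + b" using assms(2) by (simp only: add.commute)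
  then show ?thesis using assms(1) by (simp only: ennreal_add_left_cancel) simp
qed

lemma real_distribution_convolution:
  assumes "real_distribution M" "real_distribution N"
  shows "real_distribution (M \<star> N)"
proof -
  interpret M: real_distribution M by fact
  interpret N: real_distribution N by fact
  interpret pair_prob_space M N ..
  show ?thesis
    unfolding convolution_def by (rule real_distribution_distr) simp
qed

section \<open>Displacement laws along paths and the square estimate\<close>

context recurrent_walk
begin

abbreviation "reach m i j \<nu> \<equiv> shift_bound S K F m i j \<nu>"

lemma reach_Nil:
  assumes "i \<in> S"
  shows "reach 0 i i (return borel 0)"
proof -
  have "(\<integral>\<^sup>+x. f i (t - x) \<partial>return borel 0) = f i t" if "meas f" for f and t :: real
  proof -
    have [measurable]: "f i \<in> borel_measurable borel" using that assms by blast
    show ?thesis by (subst nn_integral_return) auto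
  qed
  moreover
  have "real_distribution (return borel (0 :: real))"
    by (simp add: real_distribution_def real_distribution_axioms_def prob_space_return)
  ultimately show ?thesis
    unfolding shift_bound_def by (auto intro!: exI[of _ 1])
qed

lemma reach_single:
  assumes "i \<in> S" "j \<in> S" "K i j > 0"
  shows "reach 1 i j (F i j)"
  unfolding shift_bound_def using assms distr
  by (auto intro!: exI[of _ "K i j"] simp: wop_def
      intro: nn_integral_ge_point[of j S "\<lambda>j. K i j * (\<integral>\<^sup>+x. f j (t - x) \<partial>F i j)" for f t])

text \<open>Concatenating paths adds independent displacements, so the laws convolve and the
  constants multiply.\<close>

lemma reach_append:
  assumes p: "reach m i j \<mu>" and q: "reach n j k \<nu>" and S: "i \<in> S" "j \<in> S" "k \<in> S"
  shows "reach (m + n) i k (\<mu> \<star> \<nu>)"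
proof -
  have rd: "real_distribution \<mu>" "real_distribution \<nu>"
    using p q by (auto simp: shift_bound_def)
  interpret \<mu>: real_distribution \<mu> by fact
  interpret \<nu>: real_distribution \<nu> by fact
  obtain c d where c: "c > 0" "\<And>f t. meas f \<Longrightarrow> c * (\<integral>\<^sup>+x. f j (t - x) \<partial>\<mu>) \<le> (T ^^ m) f i t"
    and d: "d > 0" "\<And>f t. meas f \<Longrightarrow> d * (\<integral>\<^sup>+x. f k (t - x) \<partial>\<nu>) \<le> (T ^^ n) f j t"
    using p q unfolding shift_bound_def by metis
  have "(c * d) * (\<integral>\<^sup>+x. f k (t - x) \<partial>(\<mu> \<star> \<nu>)) \<le> (T ^^ (m + n)) f i t" if f: "meas f" for f t
  proof -
    have [measurable]: "f k \<in> borel_measurable borel" using f S by blast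
    have "(\<integral>\<^sup>+x. f k (t - x) \<partial>(\<mu> \<star> \<nu>)) = (\<integral>\<^sup>+x. \<integral>\<^sup>+y. f k (t - (x + y)) \<partial>\<nu> \<partial>\<mu>)"
      by (rule nn_integral_convolution) (auto intro: \<mu>.finite_measure_axioms \<nu>.finite_measure_axioms)
    then have "(c * d) * (\<integral>\<^sup>+x. f k (t - x) \<partial>(\<mu> \<star> \<nu>)) = c * (\<integral>\<^sup>+x. d * (\<integral>\<^sup>+y. f k ((t - x) - y) \<partial>\<nu>) \<partial>\<mu>)"
      by (simp add: nn_integral_cmult mult.assoc diff_diff_eq)
    also have "\<dots> \<le> c * (\<integral>\<^sup>+x. (T ^^ n) f j (t - x) \<partial>\<mu>)"
      using d(2)[OF f] by (intro mult_left_mono nn_integral_mono) auto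
    also have "\<dots> \<le> (T ^^ m) ((T ^^ n) f) i t"
      using c(2) T_pow_measurable[OF f] by blast
    finally show ?thesis by (simp add: funpow_add)
  qed
  moreover have "c * d > 0" using c(1) d(1) by (simp add: ennreal_zero_less_mult_iff)
  ultimately show ?thesis
    unfolding shift_bound_def using real_distribution_convolution[OF rd] by blast
qed

text \<open>A positive entry of a kernel power contains a path of positive weight; its edges are
  peeled off one at a time.\<close>

lemma reach_exists:
  assumes "i \<in> S" "j \<in> S"
  shows "\<exists>m \<nu>. reach m i j \<nu>"
proof -
  obtain n where n: "(kop S K ^^ n) (indicator {j}) i > 0" using irreducible assms by blast
  have "\<exists>\<nu>. reach n i j \<nu>" using n assms(1)
  proof (induction n arbitrary: i)
    case 0
    then show ?case using reach_Nil[OF assms(2)] by (auto split: split_indicator_asm)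
  next
    case (Suc n)
    have "\<exists>k\<in>S. K i k * (kop S K ^^ n) (indicator {j}) k \<noteq> 0"
    proof (rule ccontr)
      assume "\<not> ?thesis"
      then have "kop S K ((kop S K ^^ n) (indicator {j})) i = 0"
        by (auto simp: kop_def nn_integral_0_iff_AE AE_count_space)
      with Suc.prems show False by simp
    qed
    then obtain k where k: "k \<in> S" "K i k > 0" "(kop S K ^^ n) (indicator {j}) k > 0"
      by (auto simp: zero_less_iff_neq_zero)
    from Suc.IH[OF k(3,1)] obtain \<nu> where "reach n k j \<nu>" by blast
    from reach_append[OF reach_single[OF Suc.prems(2) k(1,2)] this Suc.prems(2) k(1) assms(2)]
    show ?case by auto
  qed
  then show ?thesis by blast
qed

text \<open>Jensen's inequality for the square, in the form of its tangent line at
  \<open>d = p i t - q i t\<close>. It is used with \<open>q\<close> a translate of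
  \<open>p\<close>.\<close>

lemma sq_diff_subharmonic:
  assumes i: "i \<in> S" and m: "\<And>j. j \<in> S \<Longrightarrow> p j \<in> borel_measurable borel" "\<And>j. j \<in> S \<Longrightarrow> q j \<in> borel_measurable borel"
    and nonneg: "\<And>j t. j \<in> S \<Longrightarrow> 0 \<le> p j t" "\<And>j t. j \<in> S \<Longrightarrow> 0 \<le> q j t"
    and harm: "\<And>j t. j \<in> S \<Longrightarrow> T (\<lambda>j t. ennreal (p j t)) j t = ennreal (p j t)"
      "\<And>j t. j \<in> S \<Longrightarrow> T (\<lambda>j t. ennreal (q j t)) j t = ennreal (q j t)"
  shows "ennreal ((p i t - q i t)\<^sup>2) \<le> T (\<lambda>j t. ennreal ((p j t - q j t)\<^sup>2)) i t"
proof -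
  \<comment> \<open>Quantified over \<open>p\<close> and \<open>q\<close> so that the case
    \<open>p i t < q i t\<close> follows by exchanging them; the assumed order makes the slope
    \<open>2 * d\<close> nonnegative.\<close>
  have main: "ennreal ((p i t - q i t)\<^sup>2) \<le> T (\<lambda>j t. ennreal ((p j t - q j t)\<^sup>2)) i t"
    if le: "q i t \<le> p i t"
      and m [measurable]: "\<And>j. j \<in> S \<Longrightarrow> p j \<in> borel_measurable borel" "\<And>j. j \<in> S \<Longrightarrow> q j \<in> borel_measurable borel"
      and nonneg: "\<And>j t. j \<in> S \<Longrightarrow> 0 \<le> p j t" "\<And>j t. j \<in> S \<Longrightarrow> 0 \<le> q j t"
      and harm: "\<And>j t. j \<in> S \<Longrightarrow> T (\<lambda>j t. ennreal (p j t)) j t = ennreal (p j t)"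
        "\<And>j t. j \<in> S \<Longrightarrow> T (\<lambda>j t. ennreal (q j t)) j t = ennreal (q j t)"
    for p q :: "nat \<Rightarrow> real \<Rightarrow> real"
  proof -
    let ?d = "p i t - q i t"
    let ?D = "T (\<lambda>j t. ennreal ((p j t - q j t)\<^sup>2)) i t"
    \<comment> \<open>\<open>x\<^sup>2 \<ge> 2 d x - d\<^sup>2\<close> for \<open>x = p - q\<close>, arranged without subtraction\<close>
    have "ennreal (2 * ?d) * ennreal (p i t) = T (\<lambda>j t. ennreal (2 * ?d) * ennreal (p j t)) i t"
      using i by (simp add: T_cmult harm)
    also have "\<dots> \<le> T (\<lambda>j t. ennreal ((p j t - q j t)\<^sup>2) + (ennreal (2 * ?d) * ennreal (q j t) + ennreal (?d\<^sup>2))) i t"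
    proof (rule T_mono)
      fix j s assume j: "j \<in> S"
      have "0 \<le> (p j s - q j s - ?d)\<^sup>2" by simp
      then have "2 * ?d * p j s \<le> (p j s - q j s)\<^sup>2 + (2 * ?d * q j s + ?d\<^sup>2)"
        by (simp add: power2_eq_square algebra_simps)
      then show "ennreal (2 * ?d) * ennreal (p j s)
        \<le> ennreal ((p j s - q j s)\<^sup>2) + (ennreal (2 * ?d) * ennreal (q j s) + ennreal (?d\<^sup>2))"
        using le nonneg j by (simp add: ennreal_mult[symmetric] ennreal_plus[symmetric] ennreal_leI del: ennreal_plus)
    qed
    also have "\<dots> = ?D + (T (\<lambda>j t. ennreal (2 * ?d) * ennreal (q j t)) i t + T (\<lambda>_ _. ennreal (?d\<^sup>2)) i t)"
      using i by (simp add: T_add)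
    also have "\<dots> = ?D + (ennreal (2 * ?d) * ennreal (q i t) + ennreal (?d\<^sup>2))"
      using i T_pow_const[OF i, of 1 "ennreal (?d\<^sup>2)"] by (simp add: T_cmult harm)
    finally have *: "ennreal (2 * ?d * p i t) \<le> ?D + ennreal (2 * ?d * q i t + ?d\<^sup>2)"
      using le nonneg i by (simp add: ennreal_mult)
    have "2 * ?d * p i t = ?d\<^sup>2 + (2 * ?d * q i t + ?d\<^sup>2)"
      by (simp add: power2_eq_square algebra_simps)
    then have "ennreal (?d\<^sup>2) + ennreal (2 * ?d * q i t + ?d\<^sup>2) \<le> ?D + ennreal (2 * ?d * q i t + ?d\<^sup>2)"
      using * le nonneg i by (simp add: ennreal_plus[symmetric] del: ennreal_plus)
    then show ?thesis by (simp add: add.commute ennreal_add_left_cancel_le)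
  qed
  show ?thesis
  proof (cases "q i t \<le> p i t")
    case True
    then show ?thesis using m nonneg harm by (rule main)
  next
    case False
    then have "p i t \<le> q i t" by simp
    from main[OF this m(2,1) nonneg(2,1) harm(2,1)] show ?thesis
      by (simp add: power2_commute)
  qed
qed

text \<open>The key estimate: with \<open>D = T\<^sup>m z\<^sup>2 - z\<^sup>2\<close>, the sum of all \<open>T\<^sup>n D\<close> telescopes and is therefore
  finite, while \<open>D i t\<close> dominates a multiple of \<open>\<integral>(z i t - z i (t - x))\<^sup>2 \<partial>\<nu>\<close>.\<close>

lemma period_AE_point:
  fixes z :: "nat \<Rightarrow> real \<Rightarrow> real"
  assumes i: "i \<in> S" and z [measurable]: "\<And>j. j \<in> S \<Longrightarrow> z j \<in> borel_measurable borel"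
    and nonneg: "\<And>j t. j \<in> S \<Longrightarrow> 0 \<le> z j t" and bound: "\<And>j t. j \<in> S \<Longrightarrow> z j t \<le> B"
    and harm: "\<And>j t. j \<in> S \<Longrightarrow> T (\<lambda>j t. ennreal (z j t)) j t = ennreal (z j t)"
    and p: "reach m i i \<nu>"
  shows "AE x in \<nu>. z i t = z i (t - x)"
proof -
  interpret \<nu>: real_distribution \<nu> using p by (simp add: shift_bound_def)
  obtain c where c: "c > 0" "\<And>f t. meas f \<Longrightarrow> c * (\<integral>\<^sup>+x. f i (t - x) \<partial>\<nu>) \<le> (T ^^ m) f i t"
    using p unfolding shift_bound_def by metis
  define q where "q j t = ennreal ((z j t)\<^sup>2)" for j t
  define D where "D j t = (T ^^ m) q j t - q j t" for j t
  have mq: "meas q" unfolding q_def by auto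
  have mD: "meas D"
  proof
    fix j assume j: "j \<in> S"
    then have [measurable]: "(T ^^ m) q j \<in> borel_measurable borel" "q j \<in> borel_measurable borel"
      using T_pow_measurable[OF mq] mq by blast+
    show "D j \<in> borel_measurable borel" unfolding D_def by measurable
  qed
  have qB: "q j t \<le> ennreal (B\<^sup>2)" if "j \<in> S" for j t
    unfolding q_def using nonneg[OF that] bound[OF that] by (intro ennreal_leI power_mono)
  \<comment> \<open>The variance identity: the mean of \<open>z\<close> after \<open>m\<close> steps
    is \<open>z j t\<close>, by harmonicity. The cross term is added on both sides instead of being
    subtracted.\<close>
  have expand: "(T ^^ m) q j t = (T ^^ m) (\<lambda>k s. ennreal ((z k s - z j t)\<^sup>2)) j t + q j t" if j: "j \<in> S" for j t
  proof -
    let ?a = "z j t"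
    let ?L = "(T ^^ m) (\<lambda>k s. ennreal ((z k s - z j t)\<^sup>2)) j t"
    have a: "?a \<ge> 0" using nonneg j by simp
    have "?L + ennreal (2 * ?a) * ennreal ?a
       = ?L + (T ^^ m) (\<lambda>k s. ennreal (2 * ?a) * ennreal (z k s)) j t"
      using j z harm by (simp add: T_pow_cmult T_pow_fixed)
    also have "\<dots> = (T ^^ m) (\<lambda>k s. ennreal ((z k s - ?a)\<^sup>2) + ennreal (2 * ?a) * ennreal (z k s)) j t"
      using j z by (simp add: T_pow_add)
    also have "\<dots> = (T ^^ m) (\<lambda>k s. q k s + ennreal (?a\<^sup>2)) j t"
    proof (rule T_pow_cong[OF _ j])
      fix k s assume k: "k \<in> S"
      have "(z k s - ?a)\<^sup>2 + 2 * ?a * z k s = (z k s)\<^sup>2 + ?a\<^sup>2"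
        by (simp add: power2_eq_square algebra_simps)
      then show "ennreal ((z k s - ?a)\<^sup>2) + ennreal (2 * ?a) * ennreal (z k s) = q k s + ennreal (?a\<^sup>2)"
        using a nonneg[OF k, of s]
        by (simp add: q_def ennreal_mult[symmetric] ennreal_plus[symmetric] del: ennreal_plus)
    qed
    also have "\<dots> = (T ^^ m) q j t + ennreal (?a\<^sup>2)"
      using j mq by (simp add: T_pow_add T_pow_const)
    finally have "?L + q j t + ennreal (?a\<^sup>2) = (T ^^ m) q j t + ennreal (?a\<^sup>2)"
      using a by (simp add: q_def ennreal_mult[symmetric] ennreal_plus[symmetric] power2_eq_square add.assoc mult.assoc del: ennreal_plus)
    from ennreal_add_right_cancel[OF _ this] show ?thesis by simp
  qed
  have Dsq: "D j t = (T ^^ m) (\<lambda>k s. ennreal ((z k s - z j t)\<^sup>2)) j t" if j: "j \<in> S" for j t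
    using expand[OF j] unfolding D_def by (simp add: q_def)
  have Dq: "D j t + q j t = (T ^^ m) q j t" if "j \<in> S" for j t
    using expand[OF that] Dsq[OF that] by simp
  define a where "a n = (T ^^ n) q i t" for n
  have aB: "a n \<le> ennreal (B\<^sup>2)" for n
    using T_pow_mono[of q "\<lambda>_ _. ennreal (B\<^sup>2)", OF qB i] T_pow_const[OF i] by (simp add: a_def)
  \<comment> \<open>The terms are the increments \<open>a (n + m) - a n\<close>. After telescoping
    only the last \<open>m\<close> values of \<open>a\<close> remain on the upper side, each at most
    the square of \<open>B\<close>.\<close>
  have sumD: "(\<Sum>n<N. (T ^^ n) D i t) \<le> of_nat m * ennreal (B\<^sup>2)" for N
  proof -
    have "(T ^^ n) D i t + a n = a (n + m)" for n
    proof -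
      have "(T ^^ n) D i t + a n = (T ^^ n) (\<lambda>j s. D j s + q j s) i t"
        unfolding a_def using i mD mq by (simp add: T_pow_add)
      also have "\<dots> = (T ^^ n) ((T ^^ m) q) i t" using Dq i by (intro T_pow_cong)
      finally show ?thesis by (simp add: a_def funpow_add)
    qed
    then have "(\<Sum>n<N. (T ^^ n) D i t) + (\<Sum>n<N. a n) = (\<Sum>n<N. a (n + m))"
      by (simp flip: sum.distrib)
    also have "\<dots> \<le> (\<Sum>n<N + m. a n)"
    proof -
      have "(\<Sum>n<N. a (n + m)) = (\<Sum>n\<in>{m..<N+m}. a n)"
        using sum.shift_bounds_nat_ivl[of a 0 m N] by (simp add: atLeast0LessThan)
      also have "\<dots> \<le> (\<Sum>n<N + m. a n)" by (intro sum_mono2) auto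
      finally show ?thesis .
    qed
    also have "\<dots> = (\<Sum>n<N. a n) + (\<Sum>n<m. a (n + N))"
    proof -
      have "(\<Sum>n<N + m. a n) = (\<Sum>n<N. a n) + (\<Sum>n\<in>{N..<m+N}. a n)"
        by (subst sum.union_disjoint[symmetric]) (auto intro!: sum.cong)
      then show ?thesis
        using sum.shift_bounds_nat_ivl[of a 0 N m] by (simp add: atLeast0LessThan)
    qed
    also have "\<dots> \<le> (\<Sum>n<N. a n) + of_nat m * ennreal (B\<^sup>2)"
      using sum_bounded_above[of "{..<m}" "\<lambda>n. a (n + N)"] aB by (intro add_left_mono) simp
    finally have "(\<Sum>n<N. a n) + (\<Sum>n<N. (T ^^ n) D i t) \<le> (\<Sum>n<N. a n) + of_nat m * ennreal (B\<^sup>2)"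
      by (simp add: add.commute)
    moreover have "a n \<noteq> \<top>" for n using aB[of n] by (auto simp: top_unique)
    ultimately show ?thesis
      by (simp add: ennreal_add_left_cancel_le)
  qed
  have finD: "(\<Sum>n. (T ^^ n) D i t) < \<infinity>"
  proof -
    have "(\<Sum>n. (T ^^ n) D i t) \<le> of_nat m * ennreal (B\<^sup>2)"
      using sumD by (intro suminf_le_const summableI)
    also have "\<dots> < \<infinity>" by (simp add: ennreal_mult_less_top of_nat_less_top)
    finally show ?thesis .
  qed
  \<comment> \<open>Restricted to the state \<open>i\<close>, since the law \<open>\<nu>\<close>
    bounds the \<open>m\<close>-step operator from below only for cycles at
    \<open>i\<close>.\<close>
  define \<psi> where "\<psi> j s x = (if j = i then ennreal ((z j s - z j (s - x))\<^sup>2) else 0)" for j s x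
  have m\<psi>: "(\<lambda>(s, x). \<psi> j s x) \<in> borel_measurable (borel \<Otimes>\<^sub>M \<nu>)" if j: "j \<in> S" for j
  proof (cases "j = i")
    case True
    have [measurable]: "z i \<in> borel_measurable borel" using z i .
    show ?thesis using True by (simp add: \<psi>_def[abs_def])
  qed (simp add: \<psi>_def[abs_def])
  have "c * (\<integral>\<^sup>+x. (\<Sum>n. (T ^^ n) (\<lambda>j s. \<psi> j s x) i t) \<partial>\<nu>) \<le> (\<Sum>n. (T ^^ n) D i t)"
  proof -
    have mT: "(\<lambda>x. (T ^^ n) (\<lambda>j s. \<psi> j s x) i t) \<in> borel_measurable \<nu>" for n
      using measurable_compose[OF _ T_pow_measurable_param[OF m\<psi> i, where n=n], of "\<lambda>x. (t, x)" \<nu>] by simp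
    have "c * (\<integral>\<^sup>+x. (\<Sum>n. (T ^^ n) (\<lambda>j s. \<psi> j s x) i t) \<partial>\<nu>)
      = (\<Sum>n. c * (\<integral>\<^sup>+x. (T ^^ n) (\<lambda>j s. \<psi> j s x) i t \<partial>\<nu>))"
      using mT by (simp add: nn_integral_suminf)
    also have "\<dots> = (\<Sum>n. c * (T ^^ n) (\<lambda>j s. \<integral>\<^sup>+x. \<psi> j s x \<partial>\<nu>) i t)"
      using m\<psi> i \<nu>.sigma_finite_measure_axioms by (simp add: T_pow_nn_integral)
    also have "\<dots> \<le> (\<Sum>n. (T ^^ n) D i t)"
    proof (intro suminf_le summableI)
      fix n
      have mi: "meas (\<lambda>j s. \<integral>\<^sup>+x. \<psi> j s x \<partial>\<nu>)"
        using m\<psi> by (auto intro: \<nu>.borel_measurable_nn_integral)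
      have "c * (T ^^ n) (\<lambda>j s. \<integral>\<^sup>+x. \<psi> j s x \<partial>\<nu>) i t
        = (T ^^ n) (\<lambda>j s. c * (\<integral>\<^sup>+x. \<psi> j s x \<partial>\<nu>)) i t"
        using mi i by (simp add: T_pow_cmult)
      also have "\<dots> \<le> (T ^^ n) D i t"
      proof (rule T_pow_mono[OF _ i])
        fix j s assume j: "j \<in> S"
        show "c * (\<integral>\<^sup>+x. \<psi> j s x \<partial>\<nu>) \<le> D j s"
        proof (cases "j = i")
          case True
          \<comment> \<open>The cycle bound is applied to a test function whose centre
            \<open>z i s\<close> is frozen, which is the form of \<open>D i s\<close> given by
            \<open>Dsq\<close>.\<close>
          have "c * (\<integral>\<^sup>+x. ennreal ((z i (s - x) - z i s)\<^sup>2) \<partial>\<nu>) \<le> D i s"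
            using c(2)[of "\<lambda>k r. ennreal ((z k r - z i s)\<^sup>2)" s] Dsq[OF i, of s] z by simp
          then show ?thesis using True by (simp add: \<psi>_def power2_commute)
        qed (simp add: \<psi>_def)
      qed
      finally show "c * (T ^^ n) (\<lambda>j s. \<integral>\<^sup>+x. \<psi> j s x \<partial>\<nu>) i t \<le> (T ^^ n) D i t" .
    qed
    finally show ?thesis .
  qed
  then have "c * (\<integral>\<^sup>+x. (\<Sum>n. (T ^^ n) (\<lambda>j s. \<psi> j s x) i t) \<partial>\<nu>) < \<infinity>"
    using finD by (rule le_less_trans)
  then have "(\<integral>\<^sup>+x. (\<Sum>n. (T ^^ n) (\<lambda>j s. \<psi> j s x) i t) \<partial>\<nu>) \<noteq> \<infinity>"
    using c(1) by (auto simp: ennreal_mult_top split: if_splits)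
  moreover have "(\<lambda>x. \<Sum>n. (T ^^ n) (\<lambda>j s. \<psi> j s x) i t) \<in> borel_measurable \<nu>"
    using measurable_compose[OF _ T_pow_measurable_param[OF m\<psi> i], of "\<lambda>x. (t, x)" \<nu>]
    by (intro borel_measurable_suminf_order) simp
  \<comment> \<open>A function with finite integral is finite almost everywhere: for almost every
    single displacement \<open>x\<close> the potential at \<open>(i, t)\<close> is finite, as
    \<open>subharmonic_zero\<close> requires.\<close>
  ultimately have "AE x in \<nu>. (\<Sum>n. (T ^^ n) (\<lambda>j s. \<psi> j s x) i t) \<noteq> \<infinity>"
    by (intro nn_integral_PInf_AE)
  then show ?thesis
  proof eventually_elim
    case (elim x)
    have "ennreal ((z i t - z i (t - x))\<^sup>2) = 0"
    proof (rule subharmonic_zero[where \<phi>="\<lambda>j s. ennreal ((z j s - z j (s - x))\<^sup>2)" and C="ennreal (B\<^sup>2)", OF i])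
      show "meas (\<lambda>j s. ennreal ((z j s - z j (s - x))\<^sup>2))" by auto
      show "ennreal (B\<^sup>2) < \<infinity>" by simp
      show "ennreal ((z j s - z j (s - x))\<^sup>2) \<le> ennreal (B\<^sup>2)" if "j \<in> S" for j s
        using nonneg[OF that, of s] bound[OF that, of s] nonneg[OF that, of "s - x"] bound[OF that, of "s - x"]
        by (intro ennreal_leI abs_le_square_iff[THEN iffD1]) auto
      show "ennreal ((z j s - z j (s - x))\<^sup>2) \<le> T (\<lambda>j s. ennreal ((z j s - z j (s - x))\<^sup>2)) j s"
        if j: "j \<in> S" for j s
        using j z nonneg harm T_translate[of 1 "\<lambda>j t. ennreal (z j t)" x]
        by (intro sq_diff_subharmonic) auto
      show "(\<Sum>n. (T ^^ n) (\<lambda>j s. if j = i then ennreal ((z j s - z j (s - x))\<^sup>2) else 0) i t) < \<infinity>"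
        using elim by (simp add: \<psi>_def less_top)
    qed
    then show ?case by simp
  qed
qed

text \<open>The exceptional null set in \<open>period_AE_point\<close> depends on \<open>t\<close>.
  Countably many rational \<open>t\<close> share one null set, and continuity extends the identity
  to all reals.\<close>

lemma period_AE:
  fixes z :: "nat \<Rightarrow> real \<Rightarrow> real"
  assumes i: "i \<in> S" and z: "\<And>j. j \<in> S \<Longrightarrow> continuous_on UNIV (z j)"
    and nonneg: "\<And>j t. j \<in> S \<Longrightarrow> 0 \<le> z j t" and bound: "\<And>j t. j \<in> S \<Longrightarrow> z j t \<le> B"
    and harm: "\<And>j t. j \<in> S \<Longrightarrow> T (\<lambda>j t. ennreal (z j t)) j t = ennreal (z j t)"
    and p: "reach m i i \<nu>"
  shows "AE x in \<nu>. \<forall>t. z i (t - x) = z i t"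
proof -
  have "AE x in \<nu>. \<forall>t\<in>\<rat>. z i t = z i (t - x)"
    using period_AE_point[OF i _ nonneg bound harm p] borel_measurable_continuous_onI[OF z]
    by (subst AE_ball_countable) (auto simp: countable_rat)
  then show ?thesis
  proof eventually_elim
    case (elim x)
    show ?case
    proof
      fix t
      have "closed {t. z i (t - x) - z i t = 0}"
        by (intro closed_Collect_eq continuous_intros continuous_on_compose2[OF z[OF i]]) auto
      moreover have "\<rat> \<subseteq> {t. z i (t - x) - z i t = 0}" using elim by auto
      ultimately have "closure \<rat> \<subseteq> {t. z i (t - x) - z i t = 0}" by (rule closure_minimal[rotated])
      then show "z i (t - x) = z i t" by (auto simp: Rats_closure_real)
    qed
  qed
qed

end

subsection \<open>Subgroups and coboundaries\<close>

text \<open>The infimum \<open>d\<close> of the positive elements decides: \<open>d = 0\<close>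
  makes the subgroup dense, \<open>d > 0\<close> makes it cyclic. The trivial subgroup is covered by
  the value 0 of the generator.\<close>

lemma closed_real_subgroup_cases:
  fixes H :: "real set"
  assumes cl: "closed H" and zero: "0 \<in> H" and diff: "\<And>x y. x \<in> H \<Longrightarrow> y \<in> H \<Longrightarrow> x - y \<in> H"
  shows "H = UNIV \<or> (\<exists>d\<ge>0. H = range (\<lambda>k::int. d * of_int k))"
proof -
  have neg: "- x \<in> H" if "x \<in> H" for x using diff[OF zero that] by simp
  have add: "x + y \<in> H" if "x \<in> H" "y \<in> H" for x y using diff[OF that(1) neg[OF that(2)]] by simp
  have multn: "x * of_nat n \<in> H" if "x \<in> H" for x n
    using that zero add by (induction n) (simp_all add: algebra_simps)
  have mult: "x * of_int k \<in> H" if "x \<in> H" for x k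
    using multn[OF that] neg[OF multn[OF that]] by (cases k rule: int_cases2) auto
  define P where "P = H \<inter> {0<..}"
  show ?thesis
  proof (cases "P = {}")
    case True
    have "x = 0" if "x \<in> H" for x
      using True that neg[OF that] by (cases x "0 :: real" rule: linorder_cases) (auto simp: P_def)
    then have "H = {0}" using zero by auto
    then show ?thesis by (intro disjI2 exI[of _ 0]) auto
  next
    case False
    define d where "d = Inf P"
    have bdd: "bdd_below P" by (auto simp: P_def intro!: bdd_belowI[of _ 0])
    have "d \<ge> 0" unfolding d_def using False by (intro cInf_greatest) (auto simp: P_def)
    have "d \<in> closure P" unfolding d_def using False bdd by (rule closure_contains_Inf)
    also have "\<dots> \<subseteq> H" using cl by (intro closure_minimal) (auto simp: P_def)
    finally have dH: "d \<in> H" .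
    show ?thesis
    proof (cases "d = 0")
      case True
      have "x \<in> H" for x
      proof -
        have "x \<in> closure H"
          unfolding closure_approachable
        proof (intro allI impI)
          fix e :: real assume "e > 0"
          then obtain p where p: "p \<in> P" "p < e"
            using cInf_less_iff[OF False bdd, of e] True by (auto simp: d_def)
          then have "p > 0" "p \<in> H" by (auto simp: P_def)
          \<comment> \<open>The largest multiple of \<open>p\<close> below \<open>x\<close> is
            within \<open>p < e\<close> of \<open>x\<close>.\<close>
          have "x - p * of_int \<lfloor>x / p\<rfloor> = p * frac (x / p)"
            using \<open>p > 0\<close> by (simp add: frac_def field_simps)
          then have "\<bar>p * of_int \<lfloor>x / p\<rfloor> - x\<bar> = p * frac (x / p)"
            using \<open>p > 0\<close> by (simp add: abs_minus_commute)
          also have "\<dots> < p * 1" using \<open>p > 0\<close> frac_lt_1 by (intro mult_strict_left_mono)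
          finally have "dist (p * of_int \<lfloor>x / p\<rfloor>) x < e" using p by (simp add: dist_real_def)
          then show "\<exists>y\<in>H. dist y x < e" using mult[OF \<open>p \<in> H\<close>] by blast
        qed
        then show ?thesis using cl by simp
      qed
      then show ?thesis by auto
    next
      case False
      with \<open>d \<ge> 0\<close> have d: "d > 0" by simp
      have "\<exists>k::int. x = d * of_int k" if x: "x \<in> H" for x
      proof -
        \<comment> \<open>The remainder of \<open>x\<close> modulo \<open>d\<close> lies in
          \<open>H\<close> below the least positive element, so it is 0.\<close>
        define r where "r = x - d * of_int \<lfloor>x / d\<rfloor>"
        have "r \<in> H" unfolding r_def using x mult[OF dH] by (rule diff)
        have r_frac: "r = d * frac (x / d)" using d by (simp add: r_def frac_def field_simps)
        then have "0 \<le> r" "r < d" using d frac_lt_1[of "x / d"] by auto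
        have "r = 0"
        proof (rule ccontr)
          assume "r \<noteq> 0"
          then have "r \<in> P" using \<open>0 \<le> r\<close> \<open>r \<in> H\<close> by (simp add: P_def)
          then have "d \<le> r" unfolding d_def using bdd by (rule cInf_lower)
          then show False using \<open>r < d\<close> by simp
        qed
        then show ?thesis by (auto simp: r_def)
      qed
      then have "H = range (\<lambda>k::int. d * of_int k)" using mult[OF dH] by auto
      then show ?thesis using d by (intro disjI2 exI[of _ d]) auto
    qed
  qed
qed

lemma AE_convolution:
  assumes "real_distribution M" "real_distribution N" "AE x in M \<star> N. P x"
  shows "AE x in M. AE y in N. P (x + y)"
proof -
  interpret M: real_distribution M by fact
  interpret N: real_distribution N by fact
  interpret pair_prob_space M N ..
  have "AE p in M \<Otimes>\<^sub>M N. P (case p of (x, y) \<Rightarrow> x + y)"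
    using assms(3) unfolding convolution_def by (rule AE_distrD[rotated]) simp
  from AE_pair[OF this] show ?thesis by simp
qed

lemma (in prob_space) AE_imp_ex: "AE x in M. P x \<Longrightarrow> \<exists>x. P x"
  using AE_const[of False] by (metis (mono_tags, lifting) eventually_mono)

section \<open>Cycle displacements in a subgroup versus potentials modulo the subgroup\<close>

context recurrent_walk
begin

text \<open>Fix for every \<open>j\<close> one law of paths from \<open>i\<close> to
  \<open>j\<close> and one of paths back. The potential \<open>g j\<close> is a displacement from
  \<open>i\<close> to \<open>j\<close> that closes up modulo \<open>H\<close> with almost every
  return; inserting an edge from \<open>j\<close> to \<open>k\<close> compares \<open>g j\<close>
  with \<open>g k\<close>.\<close>

lemma cycles_imp_coboundary:
  assumes i: "i \<in> S" and diff: "\<And>x y. x \<in> H \<Longrightarrow> y \<in> H \<Longrightarrow> x - y \<in> H"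
    and cyc: "\<And>m \<nu>. reach m i i \<nu> \<Longrightarrow> AE x in \<nu>. x \<in> H"
  shows "\<exists>g. \<forall>j\<in>S. \<forall>k\<in>S. K j k > 0 \<longrightarrow> (AE y in F j k. y - (g k - g j) \<in> H)"
proof -
  have "\<forall>j. \<exists>\<mu>. j \<in> S \<longrightarrow> (\<exists>m. reach m i j \<mu>)" "\<forall>j. \<exists>\<nu>. j \<in> S \<longrightarrow> (\<exists>m. reach m j i \<nu>)"
    using reach_exists i by blast+
  then obtain \<mu> \<nu> where \<mu>: "\<And>j. j \<in> S \<Longrightarrow> \<exists>m. reach m i j (\<mu> j)"
    and \<nu>: "\<And>j. j \<in> S \<Longrightarrow> \<exists>m. reach m j i (\<nu> j)"
    by metis
  have rd: "real_distribution (\<mu> j)" "real_distribution (\<nu> j)" if "j \<in> S" for j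
    using \<mu>[OF that] \<nu>[OF that] by (auto simp: shift_bound_def)
  have loop: "AE x in \<mu> j. AE y in \<nu> j. x + y \<in> H" if j: "j \<in> S" for j
  proof -
    obtain m n where "reach m i j (\<mu> j)" "reach n j i (\<nu> j)" using \<mu> \<nu> j by blast
    from cyc[OF reach_append[OF this i j i]] show ?thesis
      by (rule AE_convolution[OF rd[OF j]])
  qed
  have "\<exists>x. AE y in \<nu> j. x + y \<in> H" if j: "j \<in> S" for j
  proof -
    interpret real_distribution "\<mu> j" using rd j by blast
    show ?thesis using loop[OF j] by (rule AE_imp_ex)
  qed
  then obtain g where g: "\<And>j. j \<in> S \<Longrightarrow> AE y in \<nu> j. g j + y \<in> H" by metis
  \<comment> \<open>Displacements that close up with the same return law agree modulo
    \<open>H\<close>, so \<open>g\<close> is determined modulo \<open>H\<close>.\<close>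
  have cancel: "x - y \<in> H" if k: "k \<in> S" and *: "AE w in \<nu> k. x + w \<in> H" "AE w in \<nu> k. y + w \<in> H" for k x y
  proof -
    interpret real_distribution "\<nu> k" using rd k by blast
    have "AE w in \<nu> k. x + w \<in> H \<and> y + w \<in> H" using * by simp
    then obtain w where "x + w \<in> H" "y + w \<in> H" using AE_imp_ex by blast
    from diff[OF this] show ?thesis by simp
  qed
  have "AE y in F j k. y - (g k - g j) \<in> H" if j: "j \<in> S" and k: "k \<in> S" and K: "K j k > 0" for j k
  proof -
    obtain m n where r: "reach m i j (\<mu> j)" "reach n k i (\<nu> k)" using \<mu> \<nu> j k by blast
    \<comment> \<open>The cycle runs from \<open>i\<close> to \<open>j\<close>, along the edge to
      \<open>k\<close>, and back to \<open>i\<close>.\<close>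
    have "reach (m + (1 + n)) i i (\<mu> j \<star> (F j k \<star> \<nu> k))"
      using r reach_single[OF j k K] i j k by (intro reach_append)
    from AE_convolution[OF _ _ cyc[OF this]]
    have "AE x in \<mu> j. AE s in F j k \<star> \<nu> k. x + s \<in> H"
      using rd distr j k by (simp add: real_distribution_convolution)
    then have "AE x in \<mu> j. (AE y in \<nu> j. x + y \<in> H) \<and> (AE s in F j k \<star> \<nu> k. x + s \<in> H)"
      using loop[OF j] by simp
    \<comment> \<open>One displacement \<open>x\<close> to \<open>j\<close> is chosen that closes up
      both with the direct return and with the return through \<open>k\<close>.\<close>
    then obtain x where x: "AE y in \<nu> j. x + y \<in> H" "AE s in F j k \<star> \<nu> k. x + s \<in> H"
      using prob_space.AE_imp_ex[of "\<mu> j"] rd[OF j] unfolding real_distribution_def by blast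
    have "AE y in F j k. AE w in \<nu> k. x + (y + w) \<in> H"
      using x(2) rd distr j k by (intro AE_convolution) auto
    then show ?thesis
    proof eventually_elim
      case (elim y)
      then have "(x + y) - g k \<in> H"
        using g[OF k] by (intro cancel[OF k]) (simp_all add: add.assoc)
      moreover have "x - g j \<in> H" using x(1) g[OF j] by (rule cancel[OF j])
      ultimately have "((x + y) - g k) - (x - g j) \<in> H" by (rule diff)
      then show ?case by (simp add: algebra_simps)
    qed
  qed
  then show ?thesis by blast
qed

text \<open>Corrected by the potential, the position of the walk changes at each step by an element
  of \<open>H\<close>. A walk whose corrected position starts in \<open>H\<close> therefore stays
  there, and at a return to \<open>i\<close> the corrections cancel.\<close>

lemma coboundary_imp_cycles:
  assumes i: "i \<in> S" and H [measurable]: "H \<in> sets borel"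
    and zero: "0 \<in> H" and diff: "\<And>x y. x \<in> H \<Longrightarrow> y \<in> H \<Longrightarrow> x - y \<in> H"
    and g: "\<And>j k. j \<in> S \<Longrightarrow> k \<in> S \<Longrightarrow> K j k > 0 \<Longrightarrow> AE y in F j k. y - (g k - g j) \<in> H"
    and r: "reach m i i \<nu>"
  shows "AE x in \<nu>. x \<in> H"
proof -
  interpret \<nu>: real_distribution \<nu> using r by (simp add: shift_bound_def)
  obtain c where c: "c > 0" "\<And>f t. meas f \<Longrightarrow> c * (\<integral>\<^sup>+x. f i (t - x) \<partial>\<nu>) \<le> (T ^^ m) f i t"
    using r unfolding shift_bound_def by metis
  \<comment> \<open>Here \<open>- H\<close> is the complement, so \<open>f\<close> marks corrected
    positions outside \<open>H\<close>. A step \<open>y\<close> from \<open>j\<close> to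
    \<open>k\<close> turns \<open>s + g j\<close> into
    \<open>(s + g j) - (y - (g k - g j))\<close>.\<close>
  define f :: "nat \<Rightarrow> real \<Rightarrow> ennreal" where "f j s = indicator (- H) (s + g j)" for j s
  have mf: "meas f" unfolding f_def by auto
  have Tf: "T f j s \<le> f j s" if j: "j \<in> S" for j s
  proof (cases "s + g j \<in> H")
    case True
    have "K j k * (\<integral>\<^sup>+x. f k (s - x) \<partial>F j k) = 0" if k: "k \<in> S" for k
    proof (cases "K j k = 0")
      case False
      then have "AE y in F j k. y - (g k - g j) \<in> H" using g j k by (simp add: zero_less_iff_neq_zero)
      then have "AE y in F j k. f k (s - y) = 0"
      proof eventually_elim
        case (elim y)
        have "(s + g j) - (y - (g k - g j)) \<in> H" using True elim by (rule diff)
        then show ?case by (simp add: f_def algebra_simps)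
      qed
      then have "(\<integral>\<^sup>+x. f k (s - x) \<partial>F j k) = 0"
        using shift_measurable[OF mf j k] by (simp add: nn_integral_0_iff_AE)
      then show ?thesis by simp
    qed simp
    then have "T f j s = 0" by (auto simp: wop_def nn_integral_0_iff_AE AE_count_space)
    then show ?thesis by simp
  next
    case False
    have "T f j s \<le> T (\<lambda>_ _. 1) j s" by (intro T_mono) (auto simp: f_def split: split_indicator)
    also have "\<dots> = 1" using T_pow_const[OF j, of 1 1] by simp
    finally show ?thesis using False by (simp add: f_def)
  qed
  have "(T ^^ n) f j s \<le> f j s" if "j \<in> S" for n j s
    using that
  proof (induction n arbitrary: j s)
    case (Suc n)
    have "(T ^^ Suc n) f j s \<le> T f j s" using Suc.IH by (auto intro: T_mono)
    then show ?case using Tf[OF Suc.prems, of s] by (rule order_trans)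
  qed simp
  \<comment> \<open>At the time \<open>- g i\<close> the corrected position is 0, an element of
    \<open>H\<close>.\<close>
  from this[OF i, of m "- g i"] c(2)[OF mf, of "- g i"]
  have "c * (\<integral>\<^sup>+x. f i (- g i - x) \<partial>\<nu>) \<le> f i (- g i)" by (rule order_trans[rotated])
  also have "f i (- g i) = 0" using zero by (simp add: f_def)
  finally have "(\<integral>\<^sup>+x. f i (- g i - x) \<partial>\<nu>) = 0" using c(1) by auto
  moreover have "(\<lambda>x. f i (- g i - x)) \<in> borel_measurable \<nu>" unfolding f_def by measurable
  ultimately have "AE x in \<nu>. f i (- g i - x) = 0" by (simp add: nn_integral_0_iff_AE)
  then show ?thesis
  proof eventually_elim
    case (elim x)
    then have "- x \<in> H" by (simp add: f_def split: split_indicator_asm)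
    from diff[OF zero this] show ?case by simp
  qed
qed

end

subsection \<open>The drift of a coboundary\<close>

lemma cmult_liminf_le:
  fixes c :: ennreal
  shows "c * liminf x \<le> liminf (\<lambda>n. c * x n)"
  unfolding liminf_SUP_INF SUP_mult_left_ennreal
  by (intro SUP_mono' INF_greatest mult_left_mono INF_lower) auto

text \<open>It suffices to pass to a subsequence along which \<open>x\<close> converges to its lower
  limit.\<close>

lemma liminf_add_null:
  fixes x y :: "nat \<Rightarrow> ennreal"
  assumes "y \<longlonglongrightarrow> 0"
  shows "liminf (\<lambda>n. x n + y n) \<le> liminf x"
proof -
  obtain r where r: "strict_mono r" "(x \<circ> r) \<longlonglongrightarrow> liminf x"
    using liminf_subseq_lim by blast
  have "(\<lambda>n. x (r n) + y (r n)) \<longlonglongrightarrow> liminf x + 0"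
    using r assms by (intro tendsto_add) (auto simp: o_def LIMSEQ_subseq_LIMSEQ[unfolded o_def])
  then have "liminf ((\<lambda>n. x n + y n) \<circ> r) = liminf x"
    by (intro lim_imp_Liminf) (auto simp: o_def)
  then show ?thesis using liminf_subseq_mono[OF r(1), of "\<lambda>n. x n + y n"] by simp
qed

section \<open>Entries of kernel powers and time reversal\<close>

lemma kop_pow_expand:
  "i \<in> S \<Longrightarrow> (kop S K ^^ n) f i = (\<integral>\<^sup>+j. (kop S K ^^ n) (indicator {j}) i * f j \<partial>count_space S)"
proof (induction n arbitrary: i)
  case 0
  then show ?case
    by (subst nn_integral_count_space'[where A="{i}"]) auto
next
  case (Suc n)
  have "(kop S K ^^ Suc n) f i
    = (\<integral>\<^sup>+k. K i k * (\<integral>\<^sup>+j. (kop S K ^^ n) (indicator {j}) k * f j \<partial>count_space S) \<partial>count_space S)"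
    using Suc.IH by (auto simp: kop_def[of S K "(kop S K ^^ n) f"] intro!: nn_integral_cong)
  also have "\<dots> = (\<integral>\<^sup>+k. (\<integral>\<^sup>+j. K i k * (kop S K ^^ n) (indicator {j}) k * f j \<partial>count_space S) \<partial>count_space S)"
    by (simp add: nn_integral_cmult[symmetric] mult.assoc)
  also have "\<dots> = (\<integral>\<^sup>+j. (\<integral>\<^sup>+k. K i k * (kop S K ^^ n) (indicator {j}) k * f j \<partial>count_space S) \<partial>count_space S)"
    by (intro nn_integral_count_space_nn_integral) auto
  also have "\<dots> = (\<integral>\<^sup>+j. (kop S K ^^ Suc n) (indicator {j}) i * f j \<partial>count_space S)"
    by (simp add: kop_def[of S K "(kop S K ^^ n) (indicator {j})" for j] nn_integral_multc)
  finally show ?case .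
qed

text \<open>\<open>K'\<close> is the time reversal of \<open>K\<close> with respect to the weights
  \<open>\<pi>\<close>. Read backwards, the first step of a path becomes its last, which is why the
  induction ends by moving one application of \<open>K'\<close> to the other side.\<close>

lemma kop_pow_dual:
  assumes dual: "\<And>i j. i \<in> S \<Longrightarrow> j \<in> S \<Longrightarrow> \<pi> i * K i j = \<pi> j * K' j i"
  shows "i \<in> S \<Longrightarrow> j \<in> S \<Longrightarrow>
    \<pi> i * (kop S K ^^ n) (indicator {j}) i = \<pi> j * (kop S K' ^^ n) (indicator {i}) j"
proof (induction n arbitrary: i)
  case 0
  then show ?case by (auto split: split_indicator)
next
  case (Suc n)
  have "\<pi> i * (kop S K ^^ Suc n) (indicator {j}) i
    = (\<integral>\<^sup>+l. (\<pi> i * K i l) * (kop S K ^^ n) (indicator {j}) l \<partial>count_space S)"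
    by (simp add: kop_def[of S K "(kop S K ^^ n) (indicator {j})"] nn_integral_cmult[symmetric] mult.assoc)
  also have "\<dots> = (\<integral>\<^sup>+l. \<pi> j * ((kop S K' ^^ n) (indicator {l}) j * K' l i) \<partial>count_space S)"
  proof (rule nn_integral_cong)
    fix l assume "l \<in> space (count_space S)"
    then have l: "l \<in> S" by simp
    have "(\<pi> i * K i l) * (kop S K ^^ n) (indicator {j}) l = K' l i * (\<pi> l * (kop S K ^^ n) (indicator {j}) l)"
      using dual[OF Suc.prems(1) l] by (simp add: mult_ac)
    also have "\<dots> = \<pi> j * ((kop S K' ^^ n) (indicator {l}) j * K' l i)"
      using Suc.IH[OF l Suc.prems(2)] by (simp add: mult_ac)
    finally show "(\<pi> i * K i l) * (kop S K ^^ n) (indicator {j}) l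
      = \<pi> j * ((kop S K' ^^ n) (indicator {l}) j * K' l i)" .
  qed
  also have "\<dots> = \<pi> j * (kop S K' ^^ n) (kop S K' (indicator {i})) j"
  proof -
    have "kop S K' (indicator {i}) l = K' l i" for l
      unfolding kop_def using Suc.prems by (subst nn_integral_count_space'[where A="{i}"]) auto
    then show ?thesis
      using Suc.prems by (simp add: nn_integral_cmult kop_pow_expand[where K=K' and f="kop S K' (indicator {i})"])
  qed
  finally show ?case by (simp add: funpow_swap1)
qed

section \<open>Truncated Green functions and the drift of a potential\<close>

context recurrent_kernel
begin

text \<open>The expected number of visits to \<open>i\<close> before time \<open>n\<close>; the
  target comes first and the starting state last.\<close>

definition green :: "nat \<Rightarrow> nat \<Rightarrow> nat \<Rightarrow> ennreal" where
  "green i n j = (\<Sum>k<n. (kop S K ^^ k) (indicator {i}) j)"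

lemma kop_green: "kop S K (green i n) j + indicator {i} j = green i (Suc n) j"
  unfolding green_def by (simp add: sum.lessThan_Suc_shift kop_sum add.commute del: sum.lessThan_Suc)

lemma green_mono: "green i n j \<le> green i (Suc n) j"
  by (simp add: green_def)

lemma kop_pow_le_1:
  assumes "i \<in> S"
  shows "(kop S K ^^ n) (indicator A) i \<le> 1"
proof -
  have "(kop S K ^^ n) (indicator A) i \<le> (kop S K ^^ n) (\<lambda>_. 1) i"
    using assms by (intro kop_pow_mono) (auto split: split_indicator)
  also have "\<dots> = 1" using assms
  proof (induction n arbitrary: i)
    case (Suc n)
    then have "kop S K ((kop S K ^^ n) (\<lambda>_. 1)) i = kop S K (\<lambda>_. 1) i" by (intro kop_cong)
    then show ?case using Suc.prems total by simp
  qed simp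
  finally show ?thesis .
qed

text \<open>A maximum principle: away from \<open>i\<close> the function is an average of the one
  with horizon shorter by 1, so the best start is \<open>i\<close> itself.\<close>

lemma green_le:
  assumes "i \<in> S"
  shows "j \<in> S \<Longrightarrow> green i n j \<le> green i n i"
proof (induction n arbitrary: j)
  case (Suc n)
  show ?case
  proof (cases "j = i")
    case False
    then have "green i (Suc n) j = kop S K (green i n) j" using kop_green[of i n j] by simp
    also have "\<dots> \<le> kop S K (\<lambda>_. green i n i) j" using Suc.IH by (intro kop_mono)
    also have "\<dots> = green i n i" using Suc.prems by (rule kop_const)
    also have "\<dots> \<le> green i (Suc n) i" by (rule green_mono)
    finally show ?thesis .
  qed simp
qed (simp add: green_def)

lemma green_finite:
  assumes "j \<in> S"
  shows "green i n j < \<infinity>"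
proof -
  have "green i n j \<le> of_nat (card {..<n}) * 1"
    unfolding green_def using assms by (intro sum_bounded_above kop_pow_le_1)
  then show ?thesis by (rule le_less_trans) (simp add: of_nat_less_top)
qed

lemma green_pos: "n > 0 \<Longrightarrow> green i n i > 0"
  by (cases n) (auto simp: green_def sum.lessThan_Suc_shift zero_less_iff_neq_zero simp del: sum.lessThan_Suc)

lemma green_ratio_le:
  assumes i: "i \<in> S" and j: "j \<in> S"
  shows "green i n j / green i n i \<le> 1"
  \<comment> \<open>For \<open>n = 0\<close> the ratio is \<open>0 / 0\<close>, which is 0 in
    \<open>ennreal\<close>.\<close>
  using green_le[OF i j, of n] green_pos[of n i]
  by (cases "n = 0") (auto simp: green_def[of i 0] divide_le_posI_ennreal)

lemma inverse_green_tendsto: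
  assumes "(\<Sum>n. (kop S K ^^ n) (indicator {i}) i) = \<infinity>"
  shows "(\<lambda>n. 1 / green i n i) \<longlonglongrightarrow> 0"
proof -
  have "(\<lambda>n. green i n i) \<longlonglongrightarrow> \<infinity>"
    unfolding green_def using assms summable_LIMSEQ[OF summableI, of "\<lambda>n. (kop S K ^^ n) (indicator {i}) i"] by simp
  then have "(\<lambda>n. inverse (green i n i)) \<longlonglongrightarrow> inverse \<infinity>"
    by (rule continuous_on_tendsto_compose[OF continuous_on_inverse_ennreal[OF continuous_on_id, of UNIV]]) simp_all
  then show ?thesis by (simp add: divide_ennreal_def)
qed

text \<open>The lower half of Doeblin's ratio theorem: the liminf is superharmonic by Fatou's lemma, hence constant.\<close>

lemma green_ratio_liminf:
  assumes i: "i \<in> S" and rec: "(\<Sum>n. (kop S K ^^ n) (indicator {i}) i) = \<infinity>" and j: "j \<in> S"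
  shows "liminf (\<lambda>n. green i n j / green i n i) = 1"
proof -
  define a where "a n j = green i n j / green i n i" for n j
  define \<alpha> where "\<alpha> j = liminf (\<lambda>n. a n j)" for j
  have a1: "a n j \<le> 1" if "j \<in> S" for n j
    unfolding a_def using i that by (rule green_ratio_le)
  have \<alpha>_le: "\<alpha> j \<le> 1" if "j \<in> S" for j
    unfolding \<alpha>_def using Liminf_mono[of "\<lambda>n. a n j" "\<lambda>_. 1" sequentially] a1[OF that] by (simp add: Liminf_const)
  have \<alpha>i: "\<alpha> i = 1"
  proof -
    have "eventually (\<lambda>n. a n i = 1) sequentially"
      using eventually_gt_at_top[of 0]
    proof eventually_elim
      case (elim n)
      from green_pos[OF this, of i] green_finite[OF i, of i n] show ?case
        unfolding a_def by (intro ennreal_divide_self) auto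
    qed
    then have "(\<lambda>n. a n i) \<longlonglongrightarrow> 1" by (rule tendsto_eventually)
    then show ?thesis unfolding \<alpha>_def by (intro lim_imp_Liminf) auto
  qed
  have "\<alpha> j = \<alpha> i"
  proof (rule superharmonic_const[OF _ _ j i])
    show "\<alpha> k < \<infinity>" if "k \<in> S" for k
      using \<alpha>_le[OF that] by (rule le_less_trans) simp
    show "kop S K \<alpha> k \<le> \<alpha> k" if k: "k \<in> S" for k
    proof -
      have "kop S K \<alpha> k \<le> (\<integral>\<^sup>+j. liminf (\<lambda>n. K k j * a n j) \<partial>count_space S)"
        unfolding kop_def \<alpha>_def by (intro nn_integral_mono cmult_liminf_le)
      also have "\<dots> \<le> liminf (\<lambda>n. kop S K (a n) k)"
        unfolding kop_def by (intro nn_integral_liminf) simp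
      \<comment> \<open>Applying the kernel lengthens the horizon by 1. This costs at most 1 before
        normalisation, and the normalised error tends to 0 by recurrence.\<close>
      also have "\<dots> \<le> liminf (\<lambda>n. a n k + 1 / green i n i)"
      proof (intro Liminf_mono always_eventually allI)
        fix n
        have "kop S K (a n) k = kop S K (green i n) k / green i n i"
          using kop_cmult[of S K "inverse (green i n i)" "green i n" k]
          by (simp add: a_def[abs_def] divide_ennreal_def mult.commute)
        also have "\<dots> \<le> (green i n k + 1) / green i n i"
        proof (rule divide_right_mono_ennreal)
          have "kop S K (green i n) k \<le> green i (Suc n) k"
            using kop_green[of i n k] by (metis le_iff_add)
          also have "\<dots> \<le> green i n k + 1"
            using kop_pow_le_1[OF k] by (simp add: green_def)
          finally show "kop S K (green i n) k \<le> green i n k + 1" .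
        qed
        finally show "kop S K (a n) k \<le> a n k + 1 / green i n i"
          by (simp add: a_def add_divide_distrib_ennreal)
      qed
      also have "\<dots> \<le> \<alpha> k"
        unfolding \<alpha>_def using inverse_green_tendsto[OF rec] by (rule liminf_add_null)
      finally show ?thesis .
    qed
  qed
  then show ?thesis using \<alpha>i by (simp add: \<alpha>_def a_def)
qed

text \<open>The increments of \<open>h\<close> along the chain telescope in expectation. Negative
  parts stand on the left and positive parts on the right, so that no subtraction of possibly
  infinite quantities occurs.\<close>

lemma drift_sum:
  fixes h :: "nat \<Rightarrow> real"
  assumes h: "\<And>j. 0 \<le> h j" and i: "i \<in> S"
  shows "(kop S K ^^ n) (\<lambda>j. ennreal (h j)) i
      + (\<Sum>k<n. (kop S K ^^ k) (\<lambda>i. \<integral>\<^sup>+j. K i j * ennreal (h i - h j) \<partial>count_space S) i)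
    = ennreal (h i) + (\<Sum>k<n. (kop S K ^^ k) (\<lambda>i. \<integral>\<^sup>+j. K i j * ennreal (h j - h i) \<partial>count_space S) i)"
    (is "_ + (\<Sum>k<n. (kop S K ^^ k) ?N i) = _ + (\<Sum>k<n. (kop S K ^^ k) ?P i)")
  using i
proof (induction n arbitrary: i)
  case (Suc n)
  have step: "kop S K (\<lambda>j. ennreal (h j)) i + ?N i = ennreal (h i) + ?P i" if "i \<in> S" for i
  proof -
    have "kop S K (\<lambda>j. ennreal (h j)) i + ?N i = (\<integral>\<^sup>+j. K i j * (ennreal (h j) + ennreal (h i - h j)) \<partial>count_space S)"
      by (simp add: kop_def nn_integral_add distrib_left)
    also have "\<dots> = (\<integral>\<^sup>+j. K i j * (ennreal (h i) + ennreal (h j - h i)) \<partial>count_space S)"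
    proof (intro nn_integral_cong arg_cong2[where f="(*)"] refl)
      fix j
      show "ennreal (h j) + ennreal (h i - h j) = ennreal (h i) + ennreal (h j - h i)"
        using h[of i] h[of j]
        by (cases "h i \<le> h j") (auto simp: ennreal_neg ennreal_plus[symmetric] simp del: ennreal_plus)
    qed
    also have "\<dots> = kop S K (\<lambda>_. ennreal (h i)) i + ?P i"
      by (simp add: kop_def nn_integral_add distrib_left)
    finally show ?thesis using kop_const[OF that] by simp
  qed
  have "(kop S K ^^ Suc n) (\<lambda>j. ennreal (h j)) i + (\<Sum>k<Suc n. (kop S K ^^ k) ?N i)
    = kop S K (\<lambda>i. (kop S K ^^ n) (\<lambda>j. ennreal (h j)) i + (\<Sum>k<n. (kop S K ^^ k) ?N i)) i + ?N i"
    by (simp add: sum.lessThan_Suc_shift kop_add kop_sum add_ac del: sum.lessThan_Suc)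
  also have "\<dots> = kop S K (\<lambda>i. ennreal (h i) + (\<Sum>k<n. (kop S K ^^ k) ?P i)) i + ?N i"
    using kop_cong[of S "\<lambda>i. (kop S K ^^ n) (\<lambda>j. ennreal (h j)) i + (\<Sum>k<n. (kop S K ^^ k) ?N i)"
        "\<lambda>i. ennreal (h i) + (\<Sum>k<n. (kop S K ^^ k) ?P i)" K i, OF Suc.IH] by simp
  also have "\<dots> = (kop S K (\<lambda>j. ennreal (h j)) i + ?N i) + kop S K (\<lambda>i. \<Sum>k<n. (kop S K ^^ k) ?P i) i"
    by (simp add: kop_add add_ac)
  also have "\<dots> = ennreal (h i) + (?P i + kop S K (\<lambda>i. \<Sum>k<n. (kop S K ^^ k) ?P i) i)"
    using step[OF Suc.prems] by (simp add: add.assoc)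
  also have "\<dots> = ennreal (h i) + (\<Sum>k<Suc n. (kop S K ^^ k) ?P i)"
    by (simp add: sum.lessThan_Suc_shift kop_sum del: sum.lessThan_Suc)
  finally show ?case .
qed simp

text \<open>Reversal preserves the diagonal entries of all powers, hence recurrence, and exchanges
  the endpoints of paths, hence keeps irreducibility.\<close>

lemma dual_recurrent_kernel:
  assumes \<pi>: "\<And>i. i \<in> S \<Longrightarrow> 0 < \<pi> i \<and> \<pi> i < \<infinity>"
    and dual: "\<And>i j. i \<in> S \<Longrightarrow> j \<in> S \<Longrightarrow> \<pi> i * K i j = \<pi> j * K' j i"
    and total': "\<And>i. i \<in> S \<Longrightarrow> kop S K' (\<lambda>_. 1) i = 1"
  shows "recurrent_kernel S K'"
proof
  fix i j assume ij: "i \<in> S" "j \<in> S"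
  obtain n where "(kop S K ^^ n) (indicator {i}) j > 0" using irreducible ij by blast
  then have "\<pi> j * (kop S K ^^ n) (indicator {i}) j \<noteq> 0" using \<pi>[OF ij(2)] by auto
  then have "(kop S K' ^^ n) (indicator {j}) i \<noteq> 0"
    using kop_pow_dual[of S \<pi> K K', OF dual ij(2,1)] by auto
  then show "\<exists>n. (kop S K' ^^ n) (indicator {j}) i > 0" by (auto simp: zero_less_iff_neq_zero)
next
  obtain i where i: "i \<in> S" "(\<Sum>n. (kop S K ^^ n) (indicator {i}) i) = \<infinity>" using recurrent by blast
  have "(kop S K ^^ n) (indicator {i}) i = (kop S K' ^^ n) (indicator {i}) i" for n
    using kop_pow_dual[of S \<pi> K K', OF dual i(1) i(1), of n] \<pi>[OF i(1)]
    by (auto simp: ennreal_mult_cancel_left)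
  then show "\<exists>i\<in>S. (\<Sum>n. (kop S K' ^^ n) (indicator {i}) i) = \<infinity>" using i by auto
qed (rule total')

text \<open>Summing the drift of \<open>h\<close> along the chain started in \<open>i\<close> telescopes to a bounded quantity. The weights in this
  sum are Green functions of the dual kernel; normalised, they are at most 1 and have liminf 1.\<close>

lemma bounded_drift_nonpos:
  fixes h :: "nat \<Rightarrow> real"
  assumes \<pi>: "\<And>i. i \<in> S \<Longrightarrow> 0 < \<pi> i \<and> \<pi> i < \<infinity>"
    and dual: "\<And>i j. i \<in> S \<Longrightarrow> j \<in> S \<Longrightarrow> \<pi> i * K i j = \<pi> j * K' j i"
    and total': "\<And>i. i \<in> S \<Longrightarrow> kop S K' (\<lambda>_. 1) i = 1"
    and h: "\<And>j. 0 \<le> h j" "\<And>j. h j \<le> B"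
  shows "(\<integral>\<^sup>+i. \<pi> i * (\<integral>\<^sup>+j. K i j * ennreal (h j - h i) \<partial>count_space S) \<partial>count_space S)
    \<le> (\<integral>\<^sup>+i. \<pi> i * (\<integral>\<^sup>+j. K i j * ennreal (h i - h j) \<partial>count_space S) \<partial>count_space S)"
proof -
  define p where "p i = (\<integral>\<^sup>+j. K i j * ennreal (h j - h i) \<partial>count_space S)" for i
  define q where "q i = (\<integral>\<^sup>+j. K i j * ennreal (h i - h j) \<partial>count_space S)" for i
  interpret D: recurrent_kernel S K' using \<pi> dual total' by (rule dual_recurrent_kernel)
  obtain i where i: "i \<in> S" "(\<Sum>n. (kop S K' ^^ n) (indicator {i}) i) = \<infinity>" using D.recurrent by blast
  define a where "a n j = D.green i n j / D.green i n i" for n j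
  define R where "R = (\<integral>\<^sup>+j. \<pi> j * q j \<partial>count_space S)"
  \<comment> \<open>By duality the occupation weight of \<open>j\<close> for the chain
    \<open>K\<close> started in \<open>i\<close> becomes the Green function of \<open>K'\<close>
    with target \<open>i\<close>, times \<open>\<pi> j\<close>.\<close>
  have green: "\<pi> i * (\<Sum>k<n. (kop S K ^^ k) f i) = (\<integral>\<^sup>+j. D.green i n j * (\<pi> j * f j) \<partial>count_space S)" for n f
  proof -
    have "\<pi> i * (kop S K ^^ k) f i = (\<integral>\<^sup>+j. (kop S K' ^^ k) (indicator {i}) j * (\<pi> j * f j) \<partial>count_space S)" for k
    proof -
      have "\<pi> i * (kop S K ^^ k) f i
        = (\<integral>\<^sup>+j. (\<pi> i * (kop S K ^^ k) (indicator {j}) i) * f j \<partial>count_space S)"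
        by (subst kop_pow_expand[OF i(1)]) (simp add: nn_integral_cmult[symmetric] mult.assoc)
      also have "\<dots> = (\<integral>\<^sup>+j. (kop S K' ^^ k) (indicator {i}) j * (\<pi> j * f j) \<partial>count_space S)"
        using kop_pow_dual[of S \<pi> K K', OF dual i(1)] by (intro nn_integral_cong) (simp add: mult_ac)
      finally show ?thesis .
    qed
    then have "\<pi> i * (\<Sum>k<n. (kop S K ^^ k) f i)
      = (\<Sum>k<n. \<integral>\<^sup>+j. (kop S K' ^^ k) (indicator {i}) j * (\<pi> j * f j) \<partial>count_space S)"
      by (simp add: sum_distrib_left)
    also have "\<dots> = (\<integral>\<^sup>+j. D.green i n j * (\<pi> j * f j) \<partial>count_space S)"
      by (simp add: nn_integral_sum[symmetric] D.green_def sum_distrib_right)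
    finally show ?thesis .
  qed
  have scaled: "inverse (D.green i n i) * (\<integral>\<^sup>+j. D.green i n j * f j \<partial>count_space S)
      = (\<integral>\<^sup>+j. a n j * f j \<partial>count_space S)" for n f
    by (simp add: nn_integral_cmult[symmetric] a_def divide_ennreal_def mult_ac)
  have le: "(\<integral>\<^sup>+j. a n j * (\<pi> j * p j) \<partial>count_space S) \<le> R + \<pi> i * ennreal B * (1 / D.green i n i)" for n
  proof -
    have "(\<Sum>k<n. (kop S K ^^ k) p i) \<le> ennreal B + (\<Sum>k<n. (kop S K ^^ k) q i)"
    proof -
      \<comment> \<open>The boundary terms of the telescoped sum are bounded: the initial one is
        dropped and the final one is at most \<open>B\<close>.\<close>
      have "(\<Sum>k<n. (kop S K ^^ k) p i) \<le> ennreal (h i) + (\<Sum>k<n. (kop S K ^^ k) p i)" by simp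
      also have "\<dots> = (kop S K ^^ n) (\<lambda>j. ennreal (h j)) i + (\<Sum>k<n. (kop S K ^^ k) q i)"
        unfolding p_def[abs_def] q_def[abs_def] using drift_sum[OF h(1) i(1)] by simp
      also have "(kop S K ^^ n) (\<lambda>j. ennreal (h j)) i \<le> (kop S K ^^ n) (\<lambda>_. ennreal B * indicator UNIV i) i"
        using h(2) i(1) by (intro kop_pow_mono) (auto intro: ennreal_leI)
      also have "\<dots> = ennreal B * (kop S K ^^ n) (indicator UNIV) i"
        using kop_pow_cmult[of n S K "ennreal B" "indicator UNIV" i] by simp
      also have "\<dots> \<le> ennreal B"
        using mult_left_mono[OF kop_pow_le_1[OF i(1), of n UNIV], of "ennreal B"] by simp
      finally show ?thesis by (simp add: add_right_mono)
    qed
    then have "\<pi> i * (\<Sum>k<n. (kop S K ^^ k) p i) \<le> \<pi> i * (ennreal B + (\<Sum>k<n. (kop S K ^^ k) q i))"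
      by (rule mult_left_mono) simp
    then have "(\<integral>\<^sup>+j. D.green i n j * (\<pi> j * p j) \<partial>count_space S)
      \<le> \<pi> i * ennreal B + (\<integral>\<^sup>+j. D.green i n j * (\<pi> j * q j) \<partial>count_space S)"
      by (simp add: distrib_left green)
    then have "inverse (D.green i n i) * (\<integral>\<^sup>+j. D.green i n j * (\<pi> j * p j) \<partial>count_space S)
      \<le> inverse (D.green i n i) * (\<pi> i * ennreal B + (\<integral>\<^sup>+j. D.green i n j * (\<pi> j * q j) \<partial>count_space S))"
      by (rule mult_left_mono) simp
    then have "(\<integral>\<^sup>+j. a n j * (\<pi> j * p j) \<partial>count_space S)
      \<le> \<pi> i * ennreal B * (1 / D.green i n i) + (\<integral>\<^sup>+j. a n j * (\<pi> j * q j) \<partial>count_space S)"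
      unfolding distrib_left scaled divide_ennreal_def
      by (simp only: mult_1_left mult.commute[of "inverse (D.green i n i)"])
    also have "(\<integral>\<^sup>+j. a n j * (\<pi> j * q j) \<partial>count_space S) \<le> R"
      unfolding R_def
    proof (rule nn_integral_mono)
      fix j assume "j \<in> space (count_space S)"
      then have "a n j \<le> 1" unfolding a_def using D.green_ratio_le[OF i(1)] by simp
      from mult_right_mono[OF this, of "\<pi> j * q j"] show "a n j * (\<pi> j * q j) \<le> \<pi> j * q j" by simp
    qed
    finally show ?thesis by (simp add: add.commute add_right_mono)
  qed
  \<comment> \<open>Fatou's lemma uses that the weights have lower limit 1 on the positive part;
    their bound by 1 was used for the negative part in \<open>le\<close>.\<close>
  have "(\<integral>\<^sup>+j. \<pi> j * p j \<partial>count_space S) \<le> (\<integral>\<^sup>+j. liminf (\<lambda>n. a n j * (\<pi> j * p j)) \<partial>count_space S)"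
  proof (rule nn_integral_mono)
    fix j assume "j \<in> space (count_space S)"
    then have "liminf (\<lambda>n. a n j) = 1" unfolding a_def using D.green_ratio_liminf[OF i] by simp
    then show "\<pi> j * p j \<le> liminf (\<lambda>n. a n j * (\<pi> j * p j))"
      using cmult_liminf_le[of "\<pi> j * p j" "\<lambda>n. a n j"] by (simp add: mult.commute)
  qed
  also have "\<dots> \<le> liminf (\<lambda>n. \<integral>\<^sup>+j. a n j * (\<pi> j * p j) \<partial>count_space S)"
    by (intro nn_integral_liminf) simp
  also have "\<dots> \<le> liminf (\<lambda>n. R + \<pi> i * ennreal B * (1 / D.green i n i))"
    using le by (intro Liminf_mono always_eventually allI)
  also have "\<dots> \<le> liminf (\<lambda>_ :: nat. R)"
  proof (rule liminf_add_null)
    have "\<pi> i * ennreal B < \<top>" using \<pi>[OF i(1)] by (simp add: ennreal_mult_less_top)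
    from ennreal_tendsto_cmult[OF this D.inverse_green_tendsto[OF i(2)]]
    show "(\<lambda>n. \<pi> i * ennreal B * (1 / D.green i n i)) \<longlonglongrightarrow> 0" by simp
  qed
  also have "\<dots> = R" by (simp add: Liminf_const)
  finally show ?thesis by (simp add: R_def p_def q_def)
qed

text \<open>Clamping \<open>g\<close> reduces to the bounded case. It only shrinks increments, so
  the negative part stays below \<open>?R\<close>; the positive part is recovered by Fatou's lemma,
  once in \<open>j\<close> and once in \<open>i\<close>.\<close>

lemma drift_nonpos:
  fixes g :: "nat \<Rightarrow> real"
  assumes \<pi>: "\<And>i. i \<in> S \<Longrightarrow> 0 < \<pi> i \<and> \<pi> i < \<infinity>"
    and dual: "\<And>i j. i \<in> S \<Longrightarrow> j \<in> S \<Longrightarrow> \<pi> i * K i j = \<pi> j * K' j i"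
    and total': "\<And>i. i \<in> S \<Longrightarrow> kop S K' (\<lambda>_. 1) i = 1"
  shows "(\<integral>\<^sup>+i. \<pi> i * (\<integral>\<^sup>+j. K i j * ennreal (g j - g i) \<partial>count_space S) \<partial>count_space S)
    \<le> (\<integral>\<^sup>+i. \<pi> i * (\<integral>\<^sup>+j. K i j * ennreal (g i - g j) \<partial>count_space S) \<partial>count_space S)" (is "_ \<le> ?R")
proof -
  \<comment> \<open>Clamped to \<open>[-N, N]\<close> and shifted by \<open>N\<close>, so that the
    values lie between 0 and \<open>2 * N\<close>; the shift leaves increments unchanged.\<close>
  define h where "h N j = max (- real N) (min (real N) (g j)) + real N" for N :: nat and j
  let ?e = "\<lambda>N i j. ennreal (h N j - h N i)"
  have "(\<integral>\<^sup>+i. \<pi> i * (\<integral>\<^sup>+j. K i j * ennreal (g j - g i) \<partial>count_space S) \<partial>count_space S)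
    \<le> (\<integral>\<^sup>+i. liminf (\<lambda>N. \<pi> i * (\<integral>\<^sup>+j. K i j * ?e N i j \<partial>count_space S)) \<partial>count_space S)"
  proof (rule nn_integral_mono)
    fix i
    have "(\<integral>\<^sup>+j. K i j * ennreal (g j - g i) \<partial>count_space S)
      \<le> (\<integral>\<^sup>+j. liminf (\<lambda>N. K i j * ?e N i j) \<partial>count_space S)"
    proof (rule nn_integral_mono)
      fix j
      have "eventually (\<lambda>N. real N \<ge> \<bar>g i\<bar> + \<bar>g j\<bar>) sequentially"
        using eventually_ge_at_top[of "nat \<lceil>\<bar>g i\<bar> + \<bar>g j\<bar>\<rceil>"] by eventually_elim linarith
      then have "eventually (\<lambda>N. K i j * ennreal (g j - g i) = K i j * ?e N i j) sequentially"
      proof eventually_elim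
        case (elim N)
        then have "h N j = g j + N" "h N i = g i + N" by (auto simp: h_def)
        then show ?case by simp
      qed
      then have "eventually (\<lambda>N. K i j * ?e N i j = K i j * ennreal (g j - g i)) sequentially"
        by eventually_elim simp
      then have "(\<lambda>N. K i j * ?e N i j) \<longlonglongrightarrow> K i j * ennreal (g j - g i)" by (rule tendsto_eventually)
      from lim_imp_Liminf[OF _ this]
      show "K i j * ennreal (g j - g i) \<le> liminf (\<lambda>N. K i j * ?e N i j)" by simp
    qed
    also have "\<dots> \<le> liminf (\<lambda>N. \<integral>\<^sup>+j. K i j * ?e N i j \<partial>count_space S)"
      by (intro nn_integral_liminf) simp
    finally have "\<pi> i * (\<integral>\<^sup>+j. K i j * ennreal (g j - g i) \<partial>count_space S)
      \<le> \<pi> i * liminf (\<lambda>N. \<integral>\<^sup>+j. K i j * ?e N i j \<partial>count_space S)"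
      by (rule mult_left_mono) simp
    also have "\<dots> \<le> liminf (\<lambda>N. \<pi> i * (\<integral>\<^sup>+j. K i j * ?e N i j \<partial>count_space S))"
      by (rule cmult_liminf_le)
    finally show "\<pi> i * (\<integral>\<^sup>+j. K i j * ennreal (g j - g i) \<partial>count_space S)
      \<le> liminf (\<lambda>N. \<pi> i * (\<integral>\<^sup>+j. K i j * ?e N i j \<partial>count_space S))" .
  qed
  also have "\<dots> \<le> liminf (\<lambda>N. \<integral>\<^sup>+i. \<pi> i * (\<integral>\<^sup>+j. K i j * ?e N i j \<partial>count_space S) \<partial>count_space S)"
    by (intro nn_integral_liminf) simp
  also have "\<dots> \<le> liminf (\<lambda>_ :: nat. ?R)"
  proof (intro Liminf_mono always_eventually allI)
    fix N
    have "(\<integral>\<^sup>+i. \<pi> i * (\<integral>\<^sup>+j. K i j * ?e N i j \<partial>count_space S) \<partial>count_space S)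
      \<le> (\<integral>\<^sup>+i. \<pi> i * (\<integral>\<^sup>+j. K i j * ?e N j i \<partial>count_space S) \<partial>count_space S)"
      using \<pi> dual total' by (rule bounded_drift_nonpos[where B="2 * real N"]) (simp_all add: h_def max_def min_def)
    also have "\<dots> \<le> ?R"
    proof (intro nn_integral_mono mult_left_mono)
      fix i j
      show "?e N j i \<le> ennreal (g i - g j)"
        by (cases "g j \<le> g i") (auto simp: h_def max_def min_def ennreal_neg intro!: ennreal_leI)
    qed auto
    finally show "(\<integral>\<^sup>+i. \<pi> i * (\<integral>\<^sup>+j. K i j * ?e N i j \<partial>count_space S) \<partial>count_space S) \<le> ?R" .
  qed
  also have "\<dots> = ?R" by (simp add: Liminf_const)
  finally show ?thesis .
qed

end

subsection \<open>Quasi-stochastic matrices\<close>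

lemma nn_integral_count_space_has_sum:
  fixes f :: "'a \<Rightarrow> real"
  assumes A: "countable A" and nonneg: "\<And>x. x \<in> A \<Longrightarrow> 0 \<le> f x" and sum: "(f has_sum s) A"
  shows "(\<integral>\<^sup>+x. ennreal (f x) \<partial>count_space A) = ennreal s"
proof -
  have "(\<integral>\<^sup>+x. ennreal (f x) \<partial>count_space A) = (SUP F\<in>{F. finite F \<and> F \<subseteq> A}. \<Sum>x\<in>F. ennreal (f x))"
    by (simp add: nn_integral_count_space_infsum[OF A] nonneg_infsum_complete)
  also have "\<dots> = (SUP F\<in>{F. finite F \<and> F \<subseteq> A}. ennreal (sum f F))"
    using nonneg by (intro SUP_cong refl sum_ennreal) auto
  also have "\<dots> = ennreal (infsum f A)"
    using infsum_nonneg_is_SUPREMUM_ennreal[OF has_sum_imp_summable[OF sum] nonneg] by simp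
  finally show ?thesis using infsumI[OF sum] by simp
qed

lemma nn_integral_count_space_Times:
  fixes f :: "nat \<Rightarrow> nat \<Rightarrow> ennreal"
  shows "(\<integral>\<^sup>+i. \<integral>\<^sup>+j. f i j \<partial>count_space S \<partial>count_space S) = infsum (\<lambda>(i, j). f i j) (S \<times> S)"
proof -
  have "(\<integral>\<^sup>+i. \<integral>\<^sup>+j. f i j \<partial>count_space S \<partial>count_space S)
    = (\<integral>\<^sup>+i. \<integral>\<^sup>+j. (case (i, j) of (i, j) \<Rightarrow> f i j) \<partial>count_space S \<partial>count_space S)" by simp
  also have "\<dots> = (\<integral>\<^sup>+p. (case p of (i, j) \<Rightarrow> f i j) \<partial>(count_space S \<Otimes>\<^sub>M count_space S))"
    by (rule sigma_finite_measure.nn_integral_fst[OF sigma_finite_measure_count_space_countable])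
      (simp_all add: pair_measure_countable)
  also have "\<dots> = infsum (\<lambda>(i, j). f i j) (S \<times> S)"
    by (simp add: pair_measure_countable nn_integral_count_space_infsum)
  finally show ?thesis .
qed

text \<open>The Doob transform: conjugation by the diagonal matrix of \<open>v\<close>, whose
  intermediate factors cancel along a path.\<close>

lemma mat_pow_conv_kop:
  assumes Q: "\<And>i j. i \<in> S \<Longrightarrow> j \<in> S \<Longrightarrow> 0 \<le> Q i j" and v: "\<And>i. i \<in> S \<Longrightarrow> 0 < v i" and j: "j \<in> S"
  shows "i \<in> S \<Longrightarrow> mat_pow S Q n i j * ennreal (v j)
    = ennreal (v i) * (kop S (\<lambda>i j. ennreal (Q i j * v j / v i)) ^^ n) (indicator {j}) i"
proof (induction n arbitrary: i)
  case 0
  then show ?case by (auto split: split_indicator)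
next
  case (Suc n)
  let ?K = "\<lambda>i j. ennreal (Q i j * v j / v i)"
  let ?p = "(kop S ?K ^^ n) (indicator {j})"
  have "mat_pow S Q (Suc n) i j * ennreal (v j)
    = (\<integral>\<^sup>+k. ennreal (Q i k) * (mat_pow S Q n k j * ennreal (v j)) \<partial>count_space S)"
    by (simp add: nn_integral_count_space_infsum[symmetric] nn_integral_multc[symmetric] mult.assoc)
  also have "\<dots> = (\<integral>\<^sup>+k. ennreal (v i) * (?K i k * ?p k) \<partial>count_space S)"
  proof (rule nn_integral_cong)
    fix k assume "k \<in> space (count_space S)"
    then have k: "k \<in> S" by simp
    have "ennreal (Q i k) * ennreal (v k) = ennreal (v i) * ?K i k"
      using Q[OF Suc.prems k] v[OF Suc.prems] v[OF k] by (simp add: ennreal_mult[symmetric])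
    then show "ennreal (Q i k) * (mat_pow S Q n k j * ennreal (v j)) = ennreal (v i) * (?K i k * ?p k)"
      using Suc.IH[OF k] by (simp add: mult.assoc[symmetric])
  qed
  also have "\<dots> = ennreal (v i) * kop S ?K ?p i"
    by (simp add: kop_def nn_integral_cmult)
  finally show ?case by simp
qed

text \<open>The eigenvector equation for \<open>v\<close> gives row sums 1. Conjugation by
  \<open>v\<close> changes neither the diagonal entries of powers nor the positivity of
  entries.\<close>

lemma recurrent_kernel_of_matrix:
  assumes Q: "\<And>i j. i \<in> S \<Longrightarrow> j \<in> S \<Longrightarrow> 0 \<le> Q i j" and v: "pos_right_eigenvector S Q v"
    and irred: "irreducible_mat S Q" and rec: "\<exists>i\<in>S. (\<Sum>n. mat_pow S Q (Suc n) i i) = \<infinity>"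
  shows "recurrent_kernel S (\<lambda>i j. ennreal (Q i j * v j / v i))" (is "recurrent_kernel S ?K")
proof
  have vpos: "\<And>i. i \<in> S \<Longrightarrow> 0 < v i" using v by (simp add: pos_right_eigenvector_def)
  have pow: "mat_pow S Q n i j * ennreal (v j) = ennreal (v i) * (kop S ?K ^^ n) (indicator {j}) i"
    if "j \<in> S" "i \<in> S" for i j n
    using Q vpos that by (rule mat_pow_conv_kop)
  show "kop S ?K (\<lambda>_. 1) i = 1" if i: "i \<in> S" for i
  proof -
    have "((\<lambda>j. Q i j * v j) has_sum v i) S" using v i by (simp add: pos_right_eigenvector_def)
    from has_sum_cmult_left[OF this, of "inverse (v i)"]
    have "((\<lambda>j. Q i j * v j / v i) has_sum 1) S"
      using vpos[OF i] by (simp add: divide_inverse)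
    moreover have "0 \<le> Q i j * v j / v i" if "j \<in> S" for j
      using Q[OF i that] vpos[OF i] vpos[OF that] by simp
    ultimately show ?thesis
      using nn_integral_count_space_has_sum[of S "\<lambda>j. Q i j * v j / v i" 1] by (simp add: kop_def)
  qed
  show "\<exists>n. (kop S ?K ^^ n) (indicator {j}) i > 0" if ij: "i \<in> S" "j \<in> S" for i j
  proof -
    obtain n where "mat_pow S Q n i j > 0" using irred ij unfolding irreducible_mat_def by blast
    then have "mat_pow S Q n i j * ennreal (v j) > 0"
      using vpos[OF ij(2)] by (simp add: ennreal_zero_less_mult_iff)
    then show ?thesis unfolding pow[OF ij(2,1)] by (auto simp: ennreal_zero_less_mult_iff)
  qed
  obtain i where i: "i \<in> S" "(\<Sum>n. mat_pow S Q (Suc n) i i) = \<infinity>" using rec by blast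
  have "mat_pow S Q n i i = (kop S ?K ^^ n) (indicator {i}) i" for n
    using pow[OF i(1) i(1), of n] vpos[OF i(1)]
    by (auto simp: ennreal_mult_cancel_left mult.commute[of _ "ennreal (v i)"])
  \<comment> \<open>The hypothesis sums from the first power on; the term of power 0 is added
    here.\<close>
  moreover have "(\<Sum>n. mat_pow S Q n i i) = \<infinity>"
    using i(2) suminf_offset[of "\<lambda>n. mat_pow S Q n i i" 1] by (simp del: mat_pow.simps)
  ultimately show "\<exists>i\<in>S. (\<Sum>n. (kop S ?K ^^ n) (indicator {i}) i) = \<infinity>" using i(1) by auto
qed

text \<open>This kernel is the reversal of the Doob transform with respect to the weights
  \<open>u i * v i\<close>, in which \<open>v\<close> cancels. Its row sums are 1 because
  \<open>u\<close> is a left eigenvector.\<close>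

lemma dual_kernel_total:
  assumes Q: "\<And>i j. i \<in> S \<Longrightarrow> j \<in> S \<Longrightarrow> 0 \<le> Q i j" and u: "pos_left_eigenvector S Q u" and i: "i \<in> S"
  shows "kop S (\<lambda>i j. ennreal (Q j i * u j / u i)) (\<lambda>_. 1) i = 1"
proof -
  have upos: "\<And>i. i \<in> S \<Longrightarrow> 0 < u i" using u by (simp add: pos_left_eigenvector_def)
  have "((\<lambda>j. u j * Q j i) has_sum u i) S" using u i by (simp add: pos_left_eigenvector_def)
  from has_sum_cmult_left[OF this, of "inverse (u i)"]
  have "((\<lambda>j. Q j i * u j / u i) has_sum 1) S"
    using upos[OF i] by (simp add: divide_inverse mult.commute)
  moreover have "0 \<le> Q j i * u j / u i" if "j \<in> S" for j
    using Q[OF that i] upos[OF i] upos[OF that] by simp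
  ultimately show ?thesis
    using nn_integral_count_space_has_sum[of S "\<lambda>j. Q j i * u j / u i" 1] by (simp add: kop_def)
qed

section \<open>Lattice spans and constancy of bounded harmonic functions\<close>

context recurrent_walk
begin

text \<open>The potential \<open>g\<close> may take any real values here; it is reduced modulo
  \<open>d\<close> only when compared with \<open>lattice_admissible\<close>.\<close>

definition lattice :: "real \<Rightarrow> bool" where
  "lattice d \<longleftrightarrow> d > 0 \<and> (\<exists>g. \<forall>j\<in>S. \<forall>k\<in>S. K j k > 0 \<longrightarrow>
     (AE y in F j k. y - (g k - g j) \<in> range (\<lambda>n::int. d * of_int n)))"

lemma lattice_diff:
  fixes d :: real
  assumes "x \<in> range (\<lambda>n::int. d * of_int n)" "y \<in> range (\<lambda>n::int. d * of_int n)"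
  shows "x - y \<in> range (\<lambda>n::int. d * of_int n)"
proof -
  obtain m n :: int where "x = d * of_int m" "y = d * of_int n" using assms by blast
  then have "x - y = d * of_int (m - n)" by (simp add: right_diff_distrib)
  then show ?thesis by blast
qed

text \<open>Spans without a largest one contain a strictly increasing sequence, not necessarily
  tending to infinity. A cycle displacement is almost surely a multiple of all its members, and a
  nonzero one would give strictly decreasing positive integers.\<close>

lemma unbounded_lattices_imp_degenerate:
  assumes i: "i \<in> S" and d: "lattice d" and unbounded: "\<And>d. lattice d \<Longrightarrow> \<exists>d'>d. lattice d'"
  shows "\<exists>g. \<forall>j\<in>S. \<forall>k\<in>S. K j k > 0 \<longrightarrow> (AE y in F j k. y = g k - g j)"
proof -
  have "\<exists>D. \<forall>n. lattice (D n) \<and> D n < D (Suc n)"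
    using d unbounded by (intro dependent_nat_choice[of "\<lambda>_. lattice" "\<lambda>_ d d'. d < d'"]) auto
  then obtain D where D: "\<And>n. lattice (D n)" "\<And>n. D n < D (Suc n)" by blast
  have "AE x in \<nu>. x \<in> {0}" if r: "reach m i i \<nu>" for m \<nu>
  proof -
    have "AE x in \<nu>. x \<in> range (\<lambda>k::int. D n * of_int k)" for n
    proof -
      obtain g where g: "\<And>j k. j \<in> S \<Longrightarrow> k \<in> S \<Longrightarrow> K j k > 0 \<Longrightarrow>
        AE y in F j k. y - (g k - g j) \<in> range (\<lambda>k::int. D n * of_int k)"
        using D(1)[of n] unfolding lattice_def by blast
      have "countable (range (\<lambda>k::int. D n * of_int k))" by simp
      then have "range (\<lambda>k::int. D n * of_int k) \<in> sets borel"
        by (rule sets.countable[rotated]) auto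
      moreover have "0 \<in> range (\<lambda>k::int. D n * of_int k)" by (rule range_eqI[of _ _ 0]) simp
      ultimately show ?thesis using lattice_diff g r by (rule coboundary_imp_cycles[OF i])
    qed
    then have "AE x in \<nu>. \<forall>n. x \<in> range (\<lambda>k::int. D n * of_int k)"
      by (simp add: AE_all_countable)
    then show ?thesis
    proof eventually_elim
      case (elim x)
      show ?case
      proof (rule ccontr)
        assume "x \<notin> {0}"
        then have x: "x \<noteq> 0" by simp
        have "\<forall>n. \<exists>k::int. x = D n * of_int k" using elim by blast
        then obtain k :: "nat \<Rightarrow> int" where k: "\<And>n. x = D n * of_int (k n)" by metis
        \<comment> \<open>the quotients \<open>x / D n\<close> would be an infinite descent\<close>
        have "nat \<bar>k (Suc n)\<bar> < nat \<bar>k n\<bar>" for n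
        proof -
          have pos: "0 < D n" "D n < D (Suc n)" using D[of n] by (auto simp: lattice_def)
          have "k (Suc n) \<noteq> 0" using x k[of "Suc n"] by auto
          then have "D n * real_of_int \<bar>k (Suc n)\<bar> < D (Suc n) * real_of_int \<bar>k (Suc n)\<bar>"
            using pos by (intro mult_strict_right_mono) auto
          also have "\<dots> = D n * real_of_int \<bar>k n\<bar>"
            using k[of n] k[of "Suc n"] pos by (metis abs_mult abs_of_pos less_trans of_int_abs)
          finally have "\<bar>k (Suc n)\<bar> < \<bar>k n\<bar>" using pos(1) by (simp flip: of_int_abs)
          then show ?thesis by simp
        qed
        then have "\<exists>f. \<forall>n. (f (Suc n), f n) \<in> {(a, b :: nat). a < b}"
          by (intro exI[of _ "\<lambda>n. nat \<bar>k n\<bar>"]) simp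
        then show False using wf_less by (simp add: wf_iff_no_infinite_down_chain)
      qed
    qed
  qed
  \<comment> \<open>With the trivial subgroup, a potential modulo \<open>H\<close> is an exact
    potential.\<close>
  from cycles_imp_coboundary[where H="{0}", OF i _ this]
  show ?thesis by simp
qed

text \<open>The periods of each \<open>z i\<close> form a closed subgroup containing almost all
  cycle displacements. If it is not the whole line, its generator is 0 or a span, and both
  alternatives lead to the excluded degenerate case.\<close>

lemma constant_of_nonlattice:
  fixes z :: "nat \<Rightarrow> real \<Rightarrow> real"
  assumes z: "\<And>j. j \<in> S \<Longrightarrow> continuous_on UNIV (z j)"
    and nonneg: "\<And>j t. j \<in> S \<Longrightarrow> 0 \<le> z j t" and bound: "\<And>j t. j \<in> S \<Longrightarrow> z j t \<le> B"
    and harm: "\<And>j t. j \<in> S \<Longrightarrow> T (\<lambda>j t. ennreal (z j t)) j t = ennreal (z j t)"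
    and unbounded: "\<And>d. lattice d \<Longrightarrow> \<exists>d'>d. lattice d'"
    and nondegenerate: "\<nexists>g. \<forall>j\<in>S. \<forall>k\<in>S. K j k > 0 \<longrightarrow> (AE y in F j k. y = g k - g j)"
  shows "\<exists>c. \<forall>i\<in>S. \<forall>t. z i t = c"
proof -
  have const: "z i t = z i 0" if i: "i \<in> S" for i t
  proof -
    define H where "H = {x. \<forall>t. z i (t - x) = z i t}"
    have "closed H"
      unfolding H_def
      by (intro closed_Collect_all closed_Collect_eq continuous_intros continuous_on_compose2[OF z[OF i]]) auto
    moreover have "0 \<in> H" by (simp add: H_def)
    moreover have diff: "x - y \<in> H" if "x \<in> H" "y \<in> H" for x y
    proof -
      have "z i (t - (x - y)) = z i t" for t
      proof -
        have "z i (t - (x - y)) = z i ((t + y) - x)" by (simp add: algebra_simps)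
        also have "\<dots> = z i (t + y)" using that(1) by (simp add: H_def)
        also have "\<dots> = z i ((t + y) - y)" using that(2) unfolding H_def by (metis (mono_tags) mem_Collect_eq)
        finally show ?thesis by simp
      qed
      then show ?thesis by (simp add: H_def)
    qed
    ultimately consider "H = UNIV" | d where "d \<ge> 0" "H = range (\<lambda>k::int. d * of_int k)"
      using closed_real_subgroup_cases by metis
    then show ?thesis
    proof cases
      case 1
      then have "\<forall>t. z i (t - t) = z i t" unfolding H_def by blast
      then show ?thesis by (metis diff_self)
    next
      case 2
      have cyc: "AE x in \<nu>. x \<in> H" if "reach m i i \<nu>" for m \<nu>
        unfolding H_def mem_Collect_eq using i z nonneg bound harm that by (rule period_AE)
      obtain g where g: "\<forall>j\<in>S. \<forall>k\<in>S. K j k > 0 \<longrightarrow> (AE y in F j k. y - (g k - g j) \<in> H)"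
        using cycles_imp_coboundary[of i H, OF i] diff cyc by blast
      have "\<exists>g. \<forall>j\<in>S. \<forall>k\<in>S. K j k > 0 \<longrightarrow> (AE y in F j k. y = g k - g j)"
      proof (cases "d = 0")
        case True
        then have "H = {0}" using 2 by auto
        then show ?thesis using g by auto
      next
        case False
        then have "lattice d" using 2 g unfolding lattice_def by auto
        then show ?thesis using unbounded by (rule unbounded_lattices_imp_degenerate[OF i])
      qed
      with nondegenerate show ?thesis by blast
    qed
  qed
  \<comment> \<open>Without dependence on time, harmonicity for the walk is harmonicity for the
    recurrent kernel \<open>K\<close>.\<close>
  have "z i 0 = z j 0" if ij: "i \<in> S" "j \<in> S" for i j
  proof -
    have "ennreal (z i 0) = ennreal (z j 0)"
    proof (rule superharmonic_const[OF _ _ ij])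
      fix k assume k: "k \<in> S"
      have "kop S K (\<lambda>k. ennreal (z k 0)) k = T (\<lambda>k t. ennreal (z k 0)) k 0"
        using k by (simp add: T_const_in_t)
      also have "\<dots> = T (\<lambda>k t. ennreal (z k t)) k 0"
        by (intro T_cong arg_cong[where f=ennreal] const[symmetric])
      finally show "kop S K (\<lambda>k. ennreal (z k 0)) k \<le> ennreal (z k 0)"
        using harm[OF k] by simp
    qed simp
    then show ?thesis using nonneg ij by simp
  qed
  then show ?thesis using const by metis
qed

end

section \<open>From the renewal equation to a bounded harmonic function\<close>

theorem theorem1p5:
  fixes S :: "nat set" and Q :: "nat \<Rightarrow> nat \<Rightarrow> real" and u v :: "nat \<Rightarrow> real"
    and F :: "nat \<Rightarrow> nat \<Rightarrow> real measure" and Z :: "nat \<Rightarrow> real \<Rightarrow> real"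
  assumes "index_set S"
    and "quasi_stochastic S Q"
    and "pos_left_eigenvector S Q u"
    and "pos_right_eigenvector S Q v"
    and "\<And>i j. i \<in> S \<Longrightarrow> j \<in> S \<Longrightarrow> real_distribution (F i j)"
    and "\<exists>i\<in>S. (\<Sum>n. mat_pow S Q (Suc n) i i) = \<infinity>"
    and "drift_well_defined S Q F u v"
    and "drift S Q F u v > 0"
    and "nonarithmetic S Q F u v"
    and "Z \<in> Cb S v"
    and "solves_renewal S Q F Z"
  shows "\<exists>c :: real. \<forall>i\<in>S. \<forall>t. Z i t = c * v i"
proof -
  note u = assms(3) and v = assms(4) and F = assms(5)
  have Q: "\<And>i j. i \<in> S \<Longrightarrow> j \<in> S \<Longrightarrow> 0 \<le> Q i j" and irred: "irreducible_mat S Q"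
    using assms(2) by (auto simp: quasi_stochastic_def)
  have upos: "\<And>i. i \<in> S \<Longrightarrow> 0 < u i" and vpos: "\<And>i. i \<in> S \<Longrightarrow> 0 < v i"
    using u v by (auto simp: pos_left_eigenvector_def pos_right_eigenvector_def)
  \<comment> \<open>\<open>K\<close> is the Doob transform of \<open>Q\<close> by \<open>v\<close>,
    \<open>\<pi>\<close> its invariant weights, and \<open>K'\<close> its time reversal with respect
    to \<open>\<pi>\<close>.\<close>
  define K where "K i j = ennreal (Q i j * v j / v i)" for i j
  define K' where "K' i j = ennreal (Q j i * u j / u i)" for i j
  define \<pi> where "\<pi> i = ennreal (u i * v i)" for i
  interpret recurrent_kernel S K
    unfolding K_def using Q v irred assms(6) by (rule recurrent_kernel_of_matrix)
  interpret recurrent_walk S K F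
    by (intro recurrent_walk.intro recurrent_walk_axioms.intro recurrent_kernel_axioms F)
  have K_pos: "K i j > 0 \<longleftrightarrow> u i * Q i j * v j > 0" if "i \<in> S" "j \<in> S" for i j
    using Q[OF that] upos[OF that(1)] vpos that by (auto simp: K_def zero_less_mult_iff zero_less_divide_iff)
  have \<pi>K: "\<pi> i * K i j = ennreal (u i * Q i j * v j)" if "i \<in> S" "j \<in> S" for i j
    using Q[OF that] upos[OF that(1)] vpos[OF that(1)] vpos[OF that(2)]
    by (simp add: \<pi>_def K_def ennreal_mult[symmetric] mult_ac)
  have \<pi>K': "\<pi> j * K' j i = ennreal (u i * Q i j * v j)" if "i \<in> S" "j \<in> S" for i j
    using Q[OF that] upos[OF that(1)] upos[OF that(2)] vpos[OF that(2)]
    by (simp add: \<pi>_def K'_def ennreal_mult[symmetric] mult_ac)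

  have nondegenerate: "\<nexists>g. \<forall>j\<in>S. \<forall>k\<in>S. K j k > 0 \<longrightarrow> (AE y in F j k. y = g k - g j)"
  proof
    assume "\<exists>g. \<forall>j\<in>S. \<forall>k\<in>S. K j k > 0 \<longrightarrow> (AE y in F j k. y = g k - g j)"
    then obtain g where g: "\<And>j k. j \<in> S \<Longrightarrow> k \<in> S \<Longrightarrow> K j k > 0 \<Longrightarrow> AE y in F j k. y = g k - g j" by blast
    \<comment> \<open>Where \<open>K i j > 0\<close>, the law \<open>F i j\<close> is concentrated
      at \<open>g j - g i\<close>, so both parts of the drift become those of the potential
      \<open>g\<close>.\<close>
    have *: "infsum (\<lambda>(i, j). ennreal (u i * Q i j * v j) * (\<integral>\<^sup>+x. f x \<partial>F i j)) (S \<times> S)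
      = (\<integral>\<^sup>+i. \<pi> i * (\<integral>\<^sup>+j. K i j * f (g j - g i) \<partial>count_space S) \<partial>count_space S)" for f :: "real \<Rightarrow> ennreal"
    proof -
      have "infsum (\<lambda>(i, j). ennreal (u i * Q i j * v j) * (\<integral>\<^sup>+x. f x \<partial>F i j)) (S \<times> S)
        = (\<integral>\<^sup>+i. \<integral>\<^sup>+j. ennreal (u i * Q i j * v j) * (\<integral>\<^sup>+x. f x \<partial>F i j) \<partial>count_space S \<partial>count_space S)"
        by (rule nn_integral_count_space_Times[symmetric])
      also have "\<dots> = (\<integral>\<^sup>+i. \<integral>\<^sup>+j. \<pi> i * (K i j * f (g j - g i)) \<partial>count_space S \<partial>count_space S)"
      proof (intro nn_integral_cong)
        fix i j assume "i \<in> space (count_space S)" "j \<in> space (count_space S)"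
        then have ij: "i \<in> S" "j \<in> S" by auto
        interpret real_distribution "F i j" using F ij .
        show "ennreal (u i * Q i j * v j) * (\<integral>\<^sup>+x. f x \<partial>F i j) = \<pi> i * (K i j * f (g j - g i))"
        proof (cases "K i j > 0")
          case True
          have "(\<integral>\<^sup>+x. f x \<partial>F i j) = (\<integral>\<^sup>+x. f (g j - g i) \<partial>F i j)"
            using g[OF ij True] by (intro nn_integral_cong_AE) auto
          also have "\<dots> = f (g j - g i)" using emeasure_space_1 by simp
          finally show ?thesis using \<pi>K[OF ij] by (simp add: mult.assoc[symmetric])
        next
          case False
          then show ?thesis by (simp add: \<pi>K[OF ij, symmetric] zero_less_iff_neq_zero)
        qed
      qed
      also have "\<dots> = (\<integral>\<^sup>+i. \<pi> i * (\<integral>\<^sup>+j. K i j * f (g j - g i) \<partial>count_space S) \<partial>count_space S)"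
        by (simp add: nn_integral_cmult)
      finally show ?thesis .
    qed
    have "drift_pos S Q F u v \<le> drift_neg S Q F u v"
      unfolding drift_pos_def drift_neg_def *
      using drift_nonpos[of \<pi> K' g] upos vpos \<pi>K \<pi>K' dual_kernel_total[OF Q u]
      by (simp add: \<pi>_def K'_def[abs_def])
    \<comment> \<open>Well-definedness excludes \<open>\<infinity> - \<infinity>\<close>, which is
      \<open>\<infinity>\<close> in \<open>ereal\<close>; otherwise the difference is at most
      0.\<close>
    with assms(7,8) show False
      unfolding drift_def drift_well_defined_def
      by (cases "drift_pos S Q F u v"; cases "drift_neg S Q F u v") (auto simp: top_unique)
  qed

  have admissible: "lattice_admissible S Q F u v d \<longleftrightarrow> lattice d" for d
  proof (cases "d > 0")
    case d: True
    define L where "L x = range (\<lambda>k::int. x + d * of_int k)" for x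
    have AE_iff: "measure (F j k) (L x) = 1 \<longleftrightarrow> (AE y in F j k. y - x \<in> range (\<lambda>n::int. d * of_int n))"
      if jk: "j \<in> S" "k \<in> S" for j k x
    proof -
      interpret real_distribution "F j k" using F jk .
      have "countable (L x)" by (simp add: L_def)
      then have "L x \<in> events" by (simp add: sets.countable[rotated])
      then have "prob (L x) = 1 \<longleftrightarrow> (AE y in F j k. y \<in> L x)" by (rule prob_eq_1)
      also have "(\<lambda>y. y \<in> L x) = (\<lambda>y. y - x \<in> range (\<lambda>n::int. d * of_int n))"
        by (auto simp: L_def fun_eq_iff image_iff algebra_simps)
      finally show ?thesis .
    qed
    show ?thesis
    proof
      assume "lattice_admissible S Q F u v d"
      then obtain g where "\<forall>j\<in>S. \<forall>k\<in>S. u j * Q j k * v k > 0 \<longrightarrow> measure (F j k) (L (g k - g j)) = 1"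
        unfolding lattice_admissible_def L_def by blast
      then show "lattice d"
        using d AE_iff K_pos unfolding lattice_def by blast
    next
      assume "lattice d"
      then obtain g where g: "\<And>j k. j \<in> S \<Longrightarrow> k \<in> S \<Longrightarrow> K j k > 0 \<Longrightarrow>
        AE y in F j k. y - (g k - g j) \<in> range (\<lambda>n::int. d * of_int n)"
        unfolding lattice_def by blast
      \<comment> \<open>The reduction of \<open>g\<close> modulo \<open>d\<close> lies in
        \<open>[0, d)\<close>; increments change only by multiples of \<open>d\<close>.\<close>
      define \<gamma> where "\<gamma> j = d * frac (g j / d)" for j
      have "\<gamma> j \<in> {0..<d}" for j
        using d frac_lt_1[of "g j / d"] by (simp add: \<gamma>_def)
      moreover have "measure (F j k) (L (\<gamma> k - \<gamma> j)) = 1"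
        if jk: "j \<in> S" "k \<in> S" and pos: "u j * Q j k * v k > 0" for j k
      proof -
        have "AE y in F j k. y - (g k - g j) \<in> range (\<lambda>n::int. d * of_int n)"
          using g jk pos K_pos by blast
        then have "AE y in F j k. y - (\<gamma> k - \<gamma> j) \<in> range (\<lambda>n::int. d * of_int n)"
        proof eventually_elim
          case (elim y)
          then obtain n :: int where n: "y - (g k - g j) = d * of_int n" by blast
          have "\<gamma> l = g l - d * of_int \<lfloor>g l / d\<rfloor>" for l
            using d by (simp add: \<gamma>_def frac_def field_simps)
          then have "y - (\<gamma> k - \<gamma> j) = d * of_int (n + \<lfloor>g k / d\<rfloor> - \<lfloor>g j / d\<rfloor>)"
            using n by (simp add: algebra_simps)
          then show ?case by blast
        qed
        then show ?thesis using AE_iff[OF jk] by blast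
      qed
      ultimately show "lattice_admissible S Q F u v d"
        using d unfolding lattice_admissible_def L_def by blast
    qed
  qed (simp add: lattice_admissible_def lattice_def)
  \<comment> \<open>Nonarithmetic says only that no largest span exists, so every span, if there is
    any, is exceeded by another.\<close>
  have unbounded: "\<exists>d'>d. lattice d'" if "lattice d" for d
    using assms(9) that unfolding nonarithmetic_def d_arithmetic_def admissible by (meson not_le)

  from assms(10) obtain B where B: "\<And>i t. i \<in> S \<Longrightarrow> inverse (v i) * \<bar>Z i t\<bar> \<le> B"
    unfolding Cb_def bdd_above_def by auto
  have cont: "\<And>i. i \<in> S \<Longrightarrow> continuous_on UNIV (Z i)" using assms(10) by (simp add: Cb_def)
  \<comment> \<open>Division by \<open>v\<close> makes \<open>Z\<close> bounded, and adding the
    bound \<open>B\<close> makes it nonnegative, as the operators on \<open>ennreal\<close>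
    require.\<close>
  define z where "z i t = Z i t / v i + B" for i t
  have zB: "0 \<le> z i t" "z i t \<le> 2 * B" if "i \<in> S" for i t
  proof -
    have "\<bar>Z i t / v i\<bar> \<le> B" using B[OF that, of t] vpos[OF that] by (simp add: divide_inverse abs_mult mult.commute)
    then show "0 \<le> z i t" "z i t \<le> 2 * B" unfolding z_def by linarith+
  qed
  have zcont: "continuous_on UNIV (z i)" if "i \<in> S" for i
    unfolding z_def using cont[OF that] vpos[OF that] by (intro continuous_intros) auto
  have harm: "T (\<lambda>j t. ennreal (z j t)) i t = ennreal (z i t)" if i: "i \<in> S" for i t
  proof -
    have int: "(\<integral>\<^sup>+x. ennreal (z j (t - x)) \<partial>F i j) = ennreal ((\<integral>x. Z j (t - x) \<partial>F i j) / v j + B)"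
      and nonneg: "0 \<le> (\<integral>x. Z j (t - x) \<partial>F i j) / v j + B" if j: "j \<in> S" for j
    proof -
      interpret real_distribution "F i j" using F i j .
      have "continuous_on UNIV (\<lambda>x. Z j (t - x))"
        by (intro continuous_on_compose2[OF cont[OF j]] continuous_intros) auto
      then have meas: "(\<lambda>x. Z j (t - x)) \<in> borel_measurable borel" by (rule borel_measurable_continuous_onI)
      have "\<bar>Z j (t - x)\<bar> \<le> B * v j" for x
        using B[OF j, of "t - x"] vpos[OF j] by (simp add: field_simps)
      then have Zint: "integrable (F i j) (\<lambda>x. Z j (t - x))"
        using meas by (intro integrable_const_bound[where B="B * v j"]) auto
      then have zint: "integrable (F i j) (\<lambda>x. z j (t - x))" by (simp add: z_def)
      have eq: "(\<integral>x. z j (t - x) \<partial>F i j) = (\<integral>x. Z j (t - x) \<partial>F i j) / v j + B"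
        using Zint prob_space by (simp add: z_def)
      show "(\<integral>\<^sup>+x. ennreal (z j (t - x)) \<partial>F i j) = ennreal ((\<integral>x. Z j (t - x) \<partial>F i j) / v j + B)"
        unfolding eq[symmetric] using zint zB[OF j] by (intro nn_integral_eq_integral) auto
      show "0 \<le> (\<integral>x. Z j (t - x) \<partial>F i j) / v j + B"
        unfolding eq[symmetric] using zB[OF j] by (intro integral_nonneg_AE) auto
    qed
    let ?f = "\<lambda>j. (Q i j * v j / v i) * ((\<integral>x. Z j (t - x) \<partial>F i j) / v j + B)"
    have "T (\<lambda>j t. ennreal (z j t)) i t = (\<integral>\<^sup>+j. ennreal (?f j) \<partial>count_space S)"
      unfolding wop_def
    proof (rule nn_integral_cong)
      fix j assume "j \<in> space (count_space S)"
      then have j: "j \<in> S" by simp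
      show "K i j * (\<integral>\<^sup>+x. ennreal (z j (t - x)) \<partial>F i j) = ennreal (?f j)"
        unfolding int[OF j] K_def using Q[OF i j] vpos[OF i] vpos[OF j] nonneg[OF j]
        by (intro ennreal_mult[symmetric]) auto
    qed
    also have "\<dots> = ennreal (z i t)"
    proof (rule nn_integral_count_space_has_sum)
      show "0 \<le> ?f j" if "j \<in> S" for j
        using Q[OF i that] vpos[OF i] vpos[OF that] nonneg[OF that] by simp
      have "((\<lambda>j. Q i j * (\<integral>x. Z j (t - x) \<partial>F i j)) has_sum Z i t) S"
        using assms(11) i by (simp add: solves_renewal_def)
      moreover have "((\<lambda>j. Q i j * v j) has_sum v i) S"
        using v i by (simp add: pos_right_eigenvector_def)
      \<comment> \<open>The renewal equation divided by \<open>v i\<close> is added to the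
        eigenvector equation scaled by \<open>B / v i\<close>, which accounts for the added
        constant.\<close>
      ultimately have "((\<lambda>j. Q i j * (\<integral>x. Z j (t - x) \<partial>F i j) * inverse (v i) + Q i j * v j * (B / v i))
        has_sum (Z i t * inverse (v i) + v i * (B / v i))) S"
        by (intro has_sum_add has_sum_cmult_left)
      also have "Z i t * inverse (v i) + v i * (B / v i) = z i t"
        using vpos[OF i] by (simp add: z_def divide_inverse)
      finally show "(?f has_sum z i t) S"
      proof (rule has_sum_cong[THEN iffD1, rotated])
        fix j assume "j \<in> S"
        then show "Q i j * (\<integral>x. Z j (t - x) \<partial>F i j) * inverse (v i) + Q i j * v j * (B / v i) = ?f j"
          using vpos[of j] by (simp add: divide_inverse distrib_left)
      qed
    qed simp
    finally show ?thesis .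
  qed
  obtain c where c: "\<forall>i\<in>S. \<forall>t. z i t = c"
    using constant_of_nonlattice[of z "2 * B", OF zcont zB harm unbounded nondegenerate] by blast
  have "Z i t = (c - B) * v i" if i: "i \<in> S" for i t
  proof -
    have "Z i t / v i = c - B" using c i unfolding z_def by (metis add_diff_cancel)
    then show ?thesis using vpos[OF i] by (simp add: field_simps)
  qed
  then show ?thesis by blast
qed

end
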